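(* Let $S_{\mathrm{RSL}}$ be the substitution on the alphabet $\{0,1,2,3\}$ given by $0\mapsto 01$, $1\mapsto 20$, $2\mapsto 13$, $3\mapsto 32$. Let $x=(x_n)_{n\ge 0}$ be its one-sided fixed point starting with the letter $0$, i.e. the limit of the words $S_{\mathrm{RSL}}^m(0)$ as $m\to\infty$. Let $(w_n)_{n\ge 0}\in\{\pm1\}^{\mathbb{N}_0}$ be the (balanced weight) Rudin--Shapiro-like sequence, obtained from $x$ by the letter-wise recoding $0,1\mapsto +1$ and $2,3\mapsto -1$. Then $(w_n)_{n\ge 0}$ has purely singular continuous diffraction spectrum. That is, its diffraction measure $\sigma$ on $\mathbb{R}/\mathbb{Z}$ has no atoms and is singular with respect to Lebesgue measure.
   Context: The Rudin--Shapiro-like sequence is equivalently given by $w_n=\mathrm{RSL}(n)=(-1)^{\mathrm{inv}_2(n)}$, where $\mathrm{inv}_2(n)$ is the number of occurrences of $10$ as a scattered subsequence in the binary representation of $n$, i.e. the number of pairs consisting of a digit $1$ and a digit $0$ at a later (less significant) position. "Balanced weight" means that the weights $+1$ and $-1$ are equally frequent in the sequence. Diffraction measure: for a bounded real sequence $(w_n)_{n\ge 0}$ whose autocorrelation coefficients $$\eta(k)=\lim_{N\to\infty}\frac1N\sum_{n=0}^{N-1}w_n\,w_{n+k}\qquad(k\ge 0),\qquad \eta(-k)=\eta(k),$$ all exist, the function $\eta:\mathbb{Z}\to\mathbb{R}$ is positive definite. By the Herglotz--Bochner theorem there is a unique finite positive Borel measure $\sigma$ on $\mathbb{R}/\mathbb{Z}$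 with $\eta(k)=\int_{\mathbb{R}/\mathbb{Z}}e^{2\pi i k\theta}\,d\sigma(\theta)$ for all $k\in\mathbb{Z}$. This $\sigma$ (also called the correlation measure) is the diffraction measure of the sequence. The diffraction measure on $\mathbb{R}$ of the weighted Dirac comb on $\mathbb{Z}$ is its $1$-periodic extension. For the sequence considered here the limits $\eta(k)$ exist, because the substitution $S_{\mathrm{RSL}}$ is primitive. A measure is purely singular continuous if it is nonzero, has no point masses, and is singular with respect to Lebesgue measure. *)

theory Defs
  imports "HOL-Probability.Probability"
begin

section \<open>The substitution, its fixed point and the weighted sequence\<close>

datatype letter = L0 | L1 | L2 | L3

primrec rsl_subst :: "letter \<Rightarrow> letter list" where
  "rsl_subst L0 = [L0, L1]"
| "rsl_subst L1 = [L2, L0]"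
| "rsl_subst L2 = [L1, L3]"
| "rsl_subst L3 = [L3, L2]"

definition rsl_subst_word :: "letter list \<Rightarrow> letter list" where
  "rsl_subst_word u = concat (map rsl_subst u)"

definition rsl_word :: "nat \<Rightarrow> letter list" where
  "rsl_word m = (rsl_subst_word ^^ m) [L0]"

text \<open>
  The words \<open>rsl_word m\<close> have length \<open>2 ^ m\<close> and are prefixes of each other, so their limit can
  be read off along the diagonal; see \<open>nth_rsl_word\<close> and \<open>rsl_fixpoint_fixed\<close> below.
\<close>

definition rsl_fixpoint :: "nat \<Rightarrow> letter" where
  "rsl_fixpoint n = rsl_word n ! n"

primrec rsl_weight :: "letter \<Rightarrow> real" where
  "rsl_weight L0 = 1"
| "rsl_weight L1 = 1"
| "rsl_weight L2 = -1"
| "rsl_weight L3 = -1"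

definition rsl :: "nat \<Rightarrow> real" where
  "rsl n = rsl_weight (rsl_fixpoint n)"

lemma length_rsl_subst [simp]: "length (rsl_subst a) = 2"
  by (cases a) auto

lemma length_rsl_subst_word [simp]: "length (rsl_subst_word u) = 2 * length u"
  by (induction u) (auto simp: rsl_subst_word_def)

lemma rsl_subst_word_append: "rsl_subst_word (u @ v) = rsl_subst_word u @ rsl_subst_word v"
  by (simp add: rsl_subst_word_def)

lemma nth_rsl_subst_word:
  "n < length u \<Longrightarrow> i < 2 \<Longrightarrow> rsl_subst_word u ! (2 * n + i) = rsl_subst (u ! n) ! i"
proof (induction u arbitrary: n)
  case (Cons a u)
  then show ?case
    by (cases n) (auto simp: rsl_subst_word_def nth_append)
qed simp

lemma rsl_word_Suc: "rsl_word (Suc m) = rsl_subst_word (rsl_word m)"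
  by (simp add: rsl_word_def)

lemma length_rsl_word [simp]: "length (rsl_word m) = 2 ^ m"
  by (induction m) (auto simp: rsl_word_Suc, simp add: rsl_word_def)

lemma rsl_word_Suc_prefix: "\<exists>v. rsl_word (Suc m) = rsl_word m @ v"
proof (induction m)
  case 0
  show ?case by (simp add: rsl_word_def rsl_subst_word_def)
next
  case (Suc m)
  then show ?case by (metis rsl_word_Suc rsl_subst_word_append)
qed

lemma rsl_word_prefix: "m \<le> k \<Longrightarrow> \<exists>v. rsl_word k = rsl_word m @ v"
proof (induction k rule: dec_induct)
  case (step k)
  then show ?case by (metis rsl_word_Suc_prefix append_assoc)
qed simp

lemma nth_rsl_word:
  assumes "n < 2 ^ m"
  shows "rsl_word m ! n = rsl_fixpoint n"
proof -
  obtain v where "rsl_word (max m n) = rsl_word m @ v"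
    using rsl_word_prefix[of m "max m n"] by auto
  moreover obtain v' where "rsl_word (max m n) = rsl_word n @ v'"
    using rsl_word_prefix[of n "max m n"] by auto
  ultimately show ?thesis
    using assms less_exp[of n] unfolding rsl_fixpoint_def
    by (metis length_rsl_word nth_append)
qed

lemma rsl_fixpoint_0: "rsl_fixpoint 0 = L0"
  by (simp add: rsl_fixpoint_def rsl_word_def)

lemma rsl_fixpoint_fixed:
  "rsl_subst (rsl_fixpoint n) = [rsl_fixpoint (2 * n), rsl_fixpoint (2 * n + 1)]"
proof -
  have eq: "rsl_fixpoint (2 * n + i) = rsl_subst (rsl_fixpoint n) ! i" if "i < 2" for i
  proof -
    have n: "n < 2 ^ n" by (rule less_exp)
    hence "n + 1 \<le> 2 ^ n" by linarith
    hence "2 * n + i < 2 ^ Suc n" using that unfolding power_Suc by linarith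
    then show ?thesis
      using nth_rsl_word[of "2 * n + i" "Suc n"] nth_rsl_word[OF n]
        nth_rsl_subst_word[of n "rsl_word n" i] that n
      by (simp add: rsl_word_Suc)
  qed
  show ?thesis
    using eq[of 0] eq[of 1] by (cases "rsl_fixpoint n") auto
qed


section \<open>Diffraction measures\<close>

definition autocorrelation_mean :: "(nat \<Rightarrow> real) \<Rightarrow> nat \<Rightarrow> nat \<Rightarrow> real" where
  "autocorrelation_mean w k N = (\<Sum>n<N. w n * w (n + k)) / real N"

text \<open>\<open>lim\<close> is only meaningful if the sequence converges; this is required separately below.\<close>

definition autocorrelation :: "(nat \<Rightarrow> real) \<Rightarrow> int \<Rightarrow> real" where
  "autocorrelation w k = lim (autocorrelation_mean w (nat \<bar>k\<bar>))"

text \<open>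
  The circle \<open>\<real>/\<int>\<close> is represented by its fundamental domain \<open>[0,1)\<close>. The quotient map restricts
  to a Borel isomorphism from \<open>[0,1)\<close> onto \<open>\<real>/\<int>\<close> that carries Lebesgue measure to Lebesgue
  (i.e. Haar) measure, so Borel measures on the two spaces, their atoms and their null sets
  correspond to each other. Only the Borel structure is used, not the topology of \<open>[0,1)\<close>.
\<close>

definition circle_lebesgue :: "real measure" where
  "circle_lebesgue = restrict_space lborel {0..<1}"

definition is_diffraction_measure :: "(nat \<Rightarrow> real) \<Rightarrow> real measure \<Rightarrow> bool" where
  "is_diffraction_measure w \<sigma> \<longleftrightarrow>
     (\<forall>k. convergent (autocorrelation_mean w k)) \<and>
     sets \<sigma> = sets circle_lebesgue \<and> finite_measure \<sigma> \<and>
     (\<forall>k::int. complex_of_real (autocorrelation w k) =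
        (LINT \<theta>|\<sigma>. exp (2 * of_real pi * \<i> * of_int k * of_real \<theta>)))"

text \<open>Uniqueness of such a measure is part of the Herglotz--Bochner theorem.\<close>

definition diffraction_measure :: "(nat \<Rightarrow> real) \<Rightarrow> real measure" where
  "diffraction_measure w = (THE \<sigma>. is_diffraction_measure w \<sigma>)"


section \<open>Purely singular continuous measures\<close>

definition mutually_singular :: "'a measure \<Rightarrow> 'a measure \<Rightarrow> bool" where
  "mutually_singular M N \<longleftrightarrow>
     sets M = sets N \<and> (\<exists>A \<in> null_sets M. space M - A \<in> null_sets N)"

definition purely_singular_continuous :: "real measure \<Rightarrow> bool" where
  "purely_singular_continuous \<sigma> \<longleftrightarrow>
     emeasure \<sigma> (space \<sigma>) \<noteq> 0 \<and>
     (\<forall>\<theta> \<in> space \<sigma>. emeasure \<sigma> {\<theta>} = 0) \<and>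
     mutually_singular \<sigma> circle_lebesgue"

end

theory Submission
  imports Defs
begin

text \<open>
  Let \<open>z = w + i v\<close>, where \<open>v\<close> is the product of \<open>w\<close> and the Thue--Morse sequence. Then
  \<open>z (2 n) = i cnj (z n)\<close> and \<open>z (2 n + 1) = cnj (z n)\<close>, so the correlations \<open>g\<close> of \<open>z\<close> exist and
  satisfy \<open>g (2 k) = cnj (g k)\<close> and \<open>g (2 k + 1) = i/2 (cnj (g k) - cnj (g (k + 1)))\<close>, while the means
  of \<open>z n * z (n + k)\<close> vanish; hence \<open>\<eta> = Re g\<close>.

  The diffraction measure is a weak limit of the Fejer densities \<open>|\<Sum>n<N. w n e(n \<theta>)|^2 / N\<close>,
  and it is unique by the Stone--Weierstrass theorem. The recursion makes the quadratic means of \<open>g\<close>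
  tend to 0, so by Wiener's lemma there are no atoms.
  For singularity consider the averages of \<open>e(2 ^ j \<theta>)\<close> over \<open>j < N\<close>. They tend to 0 in \<open>L^2\<close> of Lebesgue measure,
  but to \<open>-1/3\<close> in \<open>L^2\<close> of the diffraction measure: \<open>\<eta>(2 ^ j) = -1/3\<close> for all \<open>j\<close>, and the covariances
  \<open>\<eta>(2 ^ i - 2 ^ j) - 1/9\<close> depend only on \<open>d = |i - j|\<close> and alternate in \<open>d\<close> up to an exponentially small
  error. Along a subsequence both limits hold almost everywhere, which separates the two measures.
\<close>

section \<open>Correlations of the sequence\<close>

definition has_mean :: "(nat \<Rightarrow> complex) \<Rightarrow> complex \<Rightarrow> bool" where
  "has_mean f x \<longleftrightarrow> (\<lambda>N. (\<Sum>n<N. f n) / of_nat N) \<longlonglongrightarrow> x"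

lemma has_mean_unique: "has_mean f x \<Longrightarrow> has_mean f y \<Longrightarrow> x = y"
  unfolding has_mean_def by (rule LIMSEQ_unique)

lemma has_mean_const: "has_mean (\<lambda>n. c) c"
proof -
  have "\<forall>\<^sub>F N in sequentially. c = (\<Sum>n<N. c) / of_nat N"
    using eventually_gt_at_top[of 0] by eventually_elim simp
  then show ?thesis
    unfolding has_mean_def by (rule tendsto_eventually[OF eventually_mono]) simp
qed

lemma has_mean_add: "has_mean f x \<Longrightarrow> has_mean g y \<Longrightarrow> has_mean (\<lambda>n. f n + g n) (x + y)"
  unfolding has_mean_def by (drule (1) tendsto_add) (simp add: sum.distrib add_divide_distrib)

lemma has_mean_cmult: "has_mean f x \<Longrightarrow> has_mean (\<lambda>n. c * f n) (c * x)"
  unfolding has_mean_def by (drule tendsto_mult_left[of _ _ _ c]) (simp add: sum_distrib_left)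

lemma has_mean_cnj: "has_mean f x \<Longrightarrow> has_mean (\<lambda>n. cnj (f n)) (cnj x)"
  unfolding has_mean_def by (drule tendsto_cnj) simp

lemma has_mean_Re: "has_mean f x \<Longrightarrow> (\<lambda>N. (\<Sum>n<N. Re (f n)) / real N) \<longlonglongrightarrow> Re x"
  unfolding has_mean_def by (drule tendsto_Re) (simp add: Re_divide_of_nat)

lemma has_mean_norm_le:
  assumes "has_mean f x" "\<And>n. norm (f n) \<le> B"
  shows "norm x \<le> B"
proof (rule LIMSEQ_le_const2)
  show "(\<lambda>N. norm ((\<Sum>n<N. f n) / of_nat N)) \<longlonglongrightarrow> norm x"
    using assms(1) unfolding has_mean_def by (rule tendsto_norm)
  show "\<exists>N. \<forall>n\<ge>N. norm ((\<Sum>n<n. f n) / of_nat n) \<le> B"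
  proof (intro exI[of _ 1] allI impI)
    fix N :: nat assume "1 \<le> N"
    have "norm (\<Sum>n<N. f n) \<le> of_nat (card {..<N}) * B"
      using assms(2) by (intro sum_norm_bound) auto
    with \<open>1 \<le> N\<close> show "norm ((\<Sum>n<N. f n) / of_nat N) \<le> B"
      by (simp add: norm_divide field_simps)
  qed
qed

lemma filterlim_div_2: "filterlim (\<lambda>N::nat. N div 2) at_top at_top"
  unfolding filterlim_at_top
proof
  fix Z :: nat
  show "\<forall>\<^sub>F N in sequentially. Z \<le> N div 2"
    using eventually_ge_at_top[of "2 * Z"] by eventually_elim linarith
qed

text \<open>Iterating \<open>step\<close> \<open>j\<close> times shrinks the a priori bound
  \<open>K\<close> to \<open>K / 2 ^ j\<close>, while the errors, eventually below
  \<open>e / 4\<close>, add up geometrically to at most \<open>e / 2\<close>.\<close>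

lemma halving_tendsto_zero:
  fixes u \<delta> :: "nat \<Rightarrow> real"
  assumes "\<And>N. 0 \<le> u N" "\<And>N. u N \<le> K" "\<delta> \<longlonglongrightarrow> 0"
    and step: "\<And>N. u N \<le> u (N div 2) / 2 + \<delta> N"
  shows "u \<longlonglongrightarrow> 0"
proof (rule order_tendstoI)
  fix e :: real assume "0 < e"
  have "filterlim (\<lambda>N::nat. N div 2) at_top at_top"
    by (rule filterlim_div_2)
  then have div2: "\<forall>\<^sub>F N in sequentially. P (N div 2)" if "\<forall>\<^sub>F N in sequentially. P N" for P
    using that by (rule eventually_compose_filterlim[rotated])
  have \<delta>: "\<forall>\<^sub>F N in sequentially. \<delta> N < e / 4"
    using \<open>\<delta> \<longlonglongrightarrow> 0\<close> \<open>0 < e\<close> by (intro order_tendstoD) auto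
  have bound: "\<forall>\<^sub>F N in sequentially. u N \<le> K / 2 ^ j + e / 2" for j
  proof (induction j)
    case 0
    show ?case using assms(2) \<open>0 < e\<close> by (intro always_eventually allI) (simp add: add_increasing2)
  next
    case (Suc j)
    show ?case
      using div2[OF Suc] \<delta>
    proof eventually_elim
      case (elim N)
      define X where "X = K / 2 ^ j"
      have X: "K / 2 ^ Suc j = X / 2" by (simp add: X_def)
      from elim step[of N] show ?case unfolding X X_def[symmetric] by linarith
    qed
  qed
  have "(\<lambda>j. K / 2 ^ j) \<longlonglongrightarrow> 0"
    by (rule LIMSEQ_divide_realpow_zero) simp
  then obtain j where "K / 2 ^ j < e / 2"
    using \<open>0 < e\<close> by (metis eventually_happens half_gt_zero order_tendstoD(2) sequentially_bot)
  then show "\<forall>\<^sub>F N in sequentially. u N < e"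
    by (intro eventually_mono[OF bound[of j]]) linarith
next
  fix a :: real assume "a < 0"
  then show "\<forall>\<^sub>F N in sequentially. a < u N"
    using assms(1) by (intro always_eventually allI) (rule less_le_trans)
qed

lemma sum_lessThan_double: "(\<Sum>n<2 * M. f n) = (\<Sum>n<M. f (2 * n) + f (2 * n + 1))"
  for f :: "nat \<Rightarrow> 'a::comm_monoid_add"
  by (induction M) (auto simp: add.assoc)

text \<open>
  With \<open>c = 0\<close> this is the mean of two interleaved sequences; \<open>c \<noteq> 0\<close> is needed for the
  correlations at distance 1, which refer to themselves.
\<close>

lemma has_mean_self_similar:
  assumes bounded: "\<And>n. norm (f n) \<le> B" and c: "norm c \<le> 1"
    and mean: "has_mean (\<lambda>n. f (2 * n) + f (2 * n + 1) - c * cnj (f n)) \<alpha>"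
    and x: "2 * x = \<alpha> + c * cnj x"
  shows "has_mean f x"
proof -
  define S where "S N = (\<Sum>n<N. f n - x)" for N
  define A where "A N = (\<Sum>n<N. f (2 * n) + f (2 * n + 1) - c * cnj (f n) - \<alpha>)" for N
  define K where "K = B + norm x"
  have fx: "norm (f n - x) \<le> K" for n
    unfolding K_def using bounded[of n] norm_triangle_ineq4[of "f n" x] by linarith
  \<comment> \<open>Splitting by parity reduces the centred sum over \<open>2 * M\<close> terms to
    the one over \<open>M\<close> terms; the equation for \<open>x\<close> makes the constants
    match.\<close>
  have even: "S (2 * M) = A M + c * cnj (S M)" for M
  proof -
    have "S (2 * M) = (\<Sum>n<M. (f (2 * n) - x) + (f (2 * n + 1) - x))"
      unfolding S_def by (rule sum_lessThan_double)
    also have "\<dots> = (\<Sum>n<M. (f (2 * n) + f (2 * n + 1) - c * cnj (f n) - \<alpha>) + c * cnj (f n - x))"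
      using x by (intro sum.cong) (auto simp: algebra_simps)
    finally show ?thesis by (simp add: A_def S_def sum.distrib sum_distrib_left)
  qed
  \<comment> \<open>For odd \<open>N\<close> the last term is left over and costs at most
    \<open>K\<close>.\<close>
  have le: "norm (S N) \<le> norm (A (N div 2)) + norm (S (N div 2)) + K" for N
  proof -
    have "S N = S (2 * (N div 2)) + (if even N then 0 else f (N - 1) - x)"
      by (auto simp: S_def elim!: evenE oddE)
    moreover have "norm (if even N then 0 else f (N - 1) - x) \<le> K"
      using fx[of "N - 1"] by (auto intro: order_trans[OF norm_ge_zero])
    moreover have "norm (c * cnj (S M)) \<le> norm (S M)" for M
      using c by (simp add: norm_mult mult_left_le_one_le)
    ultimately show ?thesis
      using even[of "N div 2"]
      by (smt (verit, best) norm_triangle_ineq)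
  qed
  have "(\<lambda>N. (\<Sum>n<N. f (2 * n) + f (2 * n + 1) - c * cnj (f n)) / of_nat N - \<alpha>) \<longlonglongrightarrow> 0"
    using mean unfolding has_mean_def by (simp add: LIM_zero)
  then have A0: "(\<lambda>N. norm (A N) / N) \<longlonglongrightarrow> 0"
  proof (elim Lim_transform_eventually[OF tendsto_norm_zero])
    show "\<forall>\<^sub>F N in sequentially. norm ((\<Sum>n<N. f (2 * n) + f (2 * n + 1) - c * cnj (f n)) / of_nat N - \<alpha>) = norm (A N) / N"
      using eventually_gt_at_top[of 0]
    proof eventually_elim
      case (elim N)
      then have "(\<Sum>n<N. f (2 * n) + f (2 * n + 1) - c * cnj (f n)) / of_nat N - \<alpha> = A N / of_nat N"
        unfolding A_def by (subst sum_subtractf) (simp add: field_simps)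
      then show ?case by (simp add: norm_divide)
    qed
  qed
  have "(\<lambda>N. norm (S N) / N) \<longlonglongrightarrow> 0"
  proof (rule halving_tendsto_zero[where K = K and \<delta> = "\<lambda>N. norm (A (N div 2)) / (N div 2) / 2 + K / N"])
    have "filterlim (\<lambda>N::nat. N div 2) at_top at_top"
      by (rule filterlim_div_2)
    from filterlim_compose[OF A0 this]
    show "(\<lambda>N. norm (A (N div 2)) / (N div 2) / 2 + K / N) \<longlonglongrightarrow> 0"
      by (intro tendsto_add_zero tendsto_divide_zero lim_const_over_n) auto
  next
    fix N :: nat
    show "norm (S N) / N \<le> K"
    proof -
      have "norm (S N) \<le> of_nat (card {..<N}) * K"
        unfolding S_def using fx by (intro sum_norm_bound) auto
      moreover have "0 \<le> K" using fx[of 0] norm_ge_zero order_trans by blast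
      ultimately show ?thesis by (cases "N = 0") (auto simp: field_simps)
    qed
    show "norm (S N) / N \<le> norm (S (N div 2)) / (N div 2) / 2
      + (norm (A (N div 2)) / (N div 2) / 2 + K / N)"
    proof -
      \<comment> \<open>Division by zero gives 0, so for \<open>N div 2 = 0\<close> the bound
        requires \<open>y = 0\<close>; the sums it is applied to are then empty.\<close>
      have *: "y / N \<le> y / real (N div 2) / 2" if "0 \<le> y" "N div 2 = 0 \<Longrightarrow> y = 0" for y
      proof (cases "N div 2 = 0")
        case False
        have "2 * real (N div 2) \<le> N" by linarith
        with False that(1) show ?thesis
          by (simp add: divide_left_mono)
      qed (use that in auto)
      have "norm (S N) / N \<le> (norm (A (N div 2)) + norm (S (N div 2)) + K) / N"
        using le by (intro divide_right_mono) auto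
      with *[of "norm (S (N div 2))"] *[of "norm (A (N div 2))"] show ?thesis
        by (auto simp: add_divide_distrib A_def S_def)
    qed
  qed auto
  then have "(\<lambda>N. S N / of_nat N) \<longlonglongrightarrow> 0"
    by (subst tendsto_norm_zero_iff[symmetric]) (simp add: norm_divide)
  then have "(\<lambda>N. S N / of_nat N + x) \<longlonglongrightarrow> x"
    by (auto intro: tendsto_eq_intros)
  then show ?thesis
    unfolding has_mean_def
  proof (rule Lim_transform_eventually)
    show "\<forall>\<^sub>F N in sequentially. S N / of_nat N + x = (\<Sum>n<N. f n) / of_nat N"
      using eventually_gt_at_top[of 0]
      by eventually_elim (simp add: S_def sum_subtractf diff_divide_distrib)
  qed
qed

lemma has_mean_interleave:
  assumes "\<And>n. norm (f n) \<le> B" "has_mean (\<lambda>n. f (2 * n)) x" "has_mean (\<lambda>n. f (2 * n + 1)) y"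
  shows "has_mean f ((x + y) / 2)"
proof (rule has_mean_self_similar[where c = 0, OF assms(1)])
  show "has_mean (\<lambda>n. f (2 * n) + f (2 * n + 1) - 0 * cnj (f n)) (x + y)"
    using has_mean_add[OF assms(2,3)] by simp
qed auto

text \<open>The imaginary part is the weight multiplied by the Thue--Morse sign of the letter.\<close>

primrec letter_point :: "letter \<Rightarrow> complex" where
  "letter_point L0 = 1 + \<i>"
| "letter_point L1 = 1 - \<i>"
| "letter_point L2 = -1 + \<i>"
| "letter_point L3 = -1 - \<i>"

definition rsl_point :: "nat \<Rightarrow> complex" where
  "rsl_point n = letter_point (rsl_fixpoint n)"

lemma rsl_eq_Re: "rsl n = Re (rsl_point n)"
  unfolding rsl_def rsl_point_def by (cases "rsl_fixpoint n") auto

lemma rsl_point_double: "rsl_point (2 * n) = \<i> * cnj (rsl_point n)"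
  and rsl_point_double_Suc: "rsl_point (2 * n + 1) = cnj (rsl_point n)"
  using rsl_fixpoint_fixed[of n] unfolding rsl_point_def
  by (cases "rsl_fixpoint n"; auto simp: complex_eq_iff)+

lemma norm_rsl_point: "norm (rsl_point n) = sqrt 2"
  unfolding rsl_point_def by (cases "rsl_fixpoint n") (auto simp: cmod_def)

lemma rsl_point_mult_cnj: "rsl_point n * cnj (rsl_point n) = 2"
  by (simp add: complex_norm_square[symmetric] norm_rsl_point flip: of_real_power)

lemma norm_rsl_point_mult: "norm (rsl_point n * cnj (rsl_point m)) \<le> 2" "norm (rsl_point n * rsl_point m) \<le> 2"
  by (simp_all add: norm_mult norm_rsl_point)

section \<open>Correlations of the complex lift\<close>

text \<open>An even distance pairs indices of equal parity; with a conjugate the factors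
  \<open>\<i>\<close> then cancel. An odd distance mixes parities: from an odd index the second
  index is \<open>2 * (n + k + 1)\<close>, which brings in the distance
  \<open>k + 1\<close>.\<close>

lemma rsl_point_products:
  "rsl_point (2 * n) * cnj (rsl_point (2 * n + 2 * k)) = cnj (rsl_point n * cnj (rsl_point (n + k)))"
  "rsl_point (2 * n + 1) * cnj (rsl_point (2 * n + 1 + 2 * k)) = cnj (rsl_point n * cnj (rsl_point (n + k)))"
  "rsl_point (2 * n) * cnj (rsl_point (2 * n + (2 * k + 1))) = \<i> * cnj (rsl_point n * cnj (rsl_point (n + k)))"
  "rsl_point (2 * n + 1) * cnj (rsl_point (2 * n + 1 + (2 * k + 1))) = - \<i> * cnj (rsl_point n * cnj (rsl_point (n + (k + 1))))"
  "rsl_point (2 * n) * rsl_point (2 * n + 2 * k) = - cnj (rsl_point n * rsl_point (n + k))"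
  "rsl_point (2 * n + 1) * rsl_point (2 * n + 1 + 2 * k) = cnj (rsl_point n * rsl_point (n + k))"
  "rsl_point (2 * n) * rsl_point (2 * n + (2 * k + 1)) = \<i> * cnj (rsl_point n * rsl_point (n + k))"
  "rsl_point (2 * n + 1) * rsl_point (2 * n + 1 + (2 * k + 1)) = \<i> * cnj (rsl_point n * rsl_point (n + (k + 1)))"
  using rsl_point_double[of "n + k"] rsl_point_double_Suc[of "n + k"] rsl_point_double[of "n + k + 1"]
    rsl_point_double[of n] rsl_point_double_Suc[of n]
  by (simp_all add: algebra_simps)

text \<open>Since \<open>norm (rsl_point n) ^ 2 = 2\<close>, the factor 2 normalises the correlation at 0 to 1.\<close>

abbreviation "has_corr k x \<equiv> has_mean (\<lambda>n. rsl_point n * cnj (rsl_point (n + k))) (2 * x)"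
abbreviation "has_pseudo_corr k x \<equiv> has_mean (\<lambda>n. rsl_point n * rsl_point (n + k)) x"

lemma corr_0: "has_corr 0 1"
  using has_mean_const[of 2] by (simp add: rsl_point_mult_cnj)

lemma corr_double:
  assumes "has_corr k x"
  shows "has_corr (2 * k) (cnj x)"
proof -
  have eq: "2 * cnj x = (cnj (2 * x) + cnj (2 * x)) / 2" by simp
  show ?thesis
    unfolding eq
    by (rule has_mean_interleave[OF norm_rsl_point_mult(1)];
        unfold rsl_point_products; intro has_mean_cnj assms)
qed

lemma corr_double_Suc:
  assumes "has_corr k x" "has_corr (k + 1) y"
  shows "has_corr (2 * k + 1) (\<i> / 2 * (cnj x - cnj y))"
proof -
  have eq: "2 * (\<i> / 2 * (cnj x - cnj y)) = (\<i> * cnj (2 * x) + - \<i> * cnj (2 * y)) / 2"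
    by (simp add: algebra_simps)
  show ?thesis
    unfolding eq using assms
    by (intro has_mean_interleave[OF norm_rsl_point_mult(1)];
        unfold rsl_point_products; intro has_mean_cmult has_mean_cnj)
qed

text \<open>At distance 1 the odd recursion refers to itself, so the mean \<open>m\<close>, twice
  the stated value, is found from \<open>2 * m = 2 * \<i> - \<i> * cnj m\<close>, whose only
  solution is \<open>- 2 / 3 + 4 / 3 * \<i>\<close>.\<close>

lemma corr_1: "has_corr 1 (- 1 / 3 + 2 / 3 * \<i>)"
proof (rule has_mean_self_similar[where c = "- \<i>" and \<alpha> = "2 * \<i>", OF norm_rsl_point_mult(1)])
  show "has_mean (\<lambda>n. rsl_point (2 * n) * cnj (rsl_point (2 * n + 1)) +
     rsl_point (2 * n + 1) * cnj (rsl_point (2 * n + 1 + 1)) -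
     - \<i> * cnj (rsl_point n * cnj (rsl_point (n + 1)))) (2 * \<i>)"
    using has_mean_const[of "2 * \<i>"] rsl_point_products(3,4)[of _ 0] rsl_point_mult_cnj
    by (simp add: mult.commute)
qed (auto simp: complex_eq_iff)

lemma pseudo_corr_0: "has_pseudo_corr 0 0"
  using has_mean_const[of 0] rsl_point_products(5,6)[of _ 0]
  by (intro has_mean_self_similar[where c = 0 and \<alpha> = 0, OF norm_rsl_point_mult(2)]) simp_all

text \<open>Again self-referential: the mean \<open>m\<close> satisfies
  \<open>2 * m = \<i> * cnj m\<close>, and comparing absolute values forces
  \<open>m = 0\<close>.\<close>

lemma pseudo_corr_1: "has_pseudo_corr 1 0"
proof (rule has_mean_self_similar[where c = \<i> and \<alpha> = 0, OF norm_rsl_point_mult(2)])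
  show "has_mean (\<lambda>n. rsl_point (2 * n) * rsl_point (2 * n + 1) +
     rsl_point (2 * n + 1) * rsl_point (2 * n + 1 + 1) -
     \<i> * cnj (rsl_point n * rsl_point (n + 1))) 0"
    using has_mean_cmult[OF has_mean_cnj[OF pseudo_corr_0], of \<i>] rsl_point_products(7,8)[of _ 0]
    by simp
qed auto

text \<open>At an even distance the products at \<open>2 * n\<close> and \<open>2 * n + 1\<close>
  are opposite and cancel in pairs, whatever happens at distance \<open>k\<close>.\<close>

lemma pseudo_corr_double: "has_pseudo_corr (2 * k) 0"
proof (rule has_mean_self_similar[where c = 0 and \<alpha> = 0, OF norm_rsl_point_mult(2)])
  show "has_mean (\<lambda>n. rsl_point (2 * n) * rsl_point (2 * n + 2 * k) +
     rsl_point (2 * n + 1) * rsl_point (2 * n + 1 + 2 * k) -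
     0 * cnj (rsl_point n * rsl_point (n + 2 * k))) 0"
    unfolding rsl_point_products using has_mean_const[of 0] by simp
qed auto

lemma pseudo_corr_double_Suc:
  assumes "has_pseudo_corr k 0" "has_pseudo_corr (k + 1) 0"
  shows "has_pseudo_corr (2 * k + 1) 0"
proof -
  have "has_pseudo_corr (2 * k + 1) ((\<i> * cnj 0 + \<i> * cnj 0) / 2)"
    by (rule has_mean_interleave[OF norm_rsl_point_mult(2)];
        unfold rsl_point_products; intro has_mean_cmult has_mean_cnj assms)
  then show ?thesis by simp
qed

text \<open>The recursion at \<open>2 * k + 1\<close> uses \<open>k\<close> and
  \<open>k + 1\<close>. Both are smaller only for \<open>0 < k\<close>, which makes 1 a second base
  case.\<close>

lemma binary_induct_0_1 [case_names 0 1 double double_Suc]: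
  fixes k :: nat
  assumes "P 0" "P 1" "\<And>k. 0 < k \<Longrightarrow> P k \<Longrightarrow> P (2 * k)"
    and "\<And>k. 0 < k \<Longrightarrow> P k \<Longrightarrow> P (k + 1) \<Longrightarrow> P (2 * k + 1)"
  shows "P k"
proof (induction k rule: less_induct)
  case (less k)
  consider "k = 0" | "k = 1" | j where "k = 2 * j" "0 < j" | j where "k = 2 * j + 1" "0 < j"
    by (metis One_nat_def add_0 evenE mult_0_right neq0_conv oddE)
  then show ?case
    by cases (use assms less in auto)
qed

lemma corr_exists: "\<exists>x. has_corr k x"
proof (induction k rule: binary_induct_0_1)
  case (double k) then show ?case using corr_double by blast
next
  case (double_Suc k) then show ?case using corr_double_Suc by blast
qed (use corr_0 corr_1 in blast)+

lemma pseudo_corr: "has_pseudo_corr k 0"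
  by (induction k rule: binary_induct_0_1)
     (use pseudo_corr_0 pseudo_corr_1 pseudo_corr_double pseudo_corr_double_Suc in blast)+

definition rsl_corr :: "nat \<Rightarrow> complex" where
  "rsl_corr k = (THE x. has_corr k x)"

lemma has_corr_rsl_corr: "has_corr k (rsl_corr k)"
proof -
  have "\<exists>!x. has_corr k x"
    using corr_exists[of k] has_mean_unique by fastforce
  then show ?thesis
    unfolding rsl_corr_def by (rule theI')
qed

lemma rsl_corr_eqI: "has_corr k x \<Longrightarrow> rsl_corr k = x"
  using has_mean_unique[OF has_corr_rsl_corr, of k "2 * x"] by simp

lemma rsl_corr_0 [simp]: "rsl_corr 0 = 1"
  and rsl_corr_1: "rsl_corr 1 = - 1 / 3 + 2 / 3 * \<i>"
  and rsl_corr_double: "rsl_corr (2 * k) = cnj (rsl_corr k)"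
  and rsl_corr_double_Suc: "rsl_corr (2 * k + 1) = \<i> / 2 * (cnj (rsl_corr k) - cnj (rsl_corr (k + 1)))"
  by (intro rsl_corr_eqI corr_0 corr_1 corr_double corr_double_Suc has_corr_rsl_corr)+

lemma norm_rsl_corr_le: "norm (rsl_corr k) \<le> 1"
  using has_mean_norm_le[OF has_corr_rsl_corr norm_rsl_point_mult(1)] by (simp add: norm_mult)

lemma autocorrelation_mean_rsl: "autocorrelation_mean rsl k \<longlonglongrightarrow> Re (rsl_corr k)"
proof -
  \<comment> \<open>The factor \<open>1 / 2\<close> undoes the normalisation in
    \<open>has_corr\<close>; the term without conjugate has mean 0 by
    \<open>pseudo_corr\<close>.\<close>
  have "Re z * Re w = Re (1 / 2 * (z * cnj w + z * w))" for z w
    by (simp add: field_simps)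
  then have eq: "autocorrelation_mean rsl k = (\<lambda>N. (\<Sum>n<N. Re (1 / 2 *
      (rsl_point n * cnj (rsl_point (n + k)) + rsl_point n * rsl_point (n + k)))) / real N)"
    by (simp add: autocorrelation_mean_def rsl_eq_Re fun_eq_iff)
  show ?thesis
    unfolding eq
    using has_mean_Re[OF has_mean_cmult[OF has_mean_add[OF has_corr_rsl_corr[of k] pseudo_corr[of k]], of "1 / 2"]]
    by simp
qed

lemma autocorrelation_rsl: "autocorrelation rsl k = Re (rsl_corr (nat \<bar>k\<bar>))"
  unfolding autocorrelation_def by (intro limI autocorrelation_mean_rsl)

section \<open>Fourier coefficients of measures on the circle\<close>

definition fourier_char :: "int \<Rightarrow> real \<Rightarrow> complex" where
  "fourier_char k \<theta> = exp (2 * of_real pi * \<i> * of_int k * of_real \<theta>)"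

lemma fourier_char_cis: "fourier_char k \<theta> = cis (2 * pi * of_int k * \<theta>)"
  by (simp add: fourier_char_def cis_conv_exp mult_ac)

lemma norm_fourier_char [simp]: "norm (fourier_char k \<theta>) = 1"
  by (simp add: fourier_char_cis)

lemma fourier_char_0 [simp]: "fourier_char 0 \<theta> = 1"
  by (simp add: fourier_char_cis)

lemma fourier_char_add: "fourier_char (k + l) \<theta> = fourier_char k \<theta> * fourier_char l \<theta>"
  by (simp add: fourier_char_cis cis_mult algebra_simps)

lemma fourier_char_minus: "fourier_char (- k) \<theta> = cnj (fourier_char k \<theta>)"
  by (simp add: fourier_char_cis cis_cnj)

lemma fourier_char_diff: "fourier_char (k - l) \<theta> = fourier_char k \<theta> * cnj (fourier_char l \<theta>)"
  using fourier_char_add[of k "- l"] by (simp add: fourier_char_minus)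

lemma fourier_char_of_nat: "fourier_char (int n) \<theta> = fourier_char 1 \<theta> ^ n"
  using Complex.DeMoivre[of "2 * pi * \<theta>" n] by (simp add: fourier_char_cis mult_ac)

lemma fourier_char_of_int: "fourier_char k (of_int m) = 1"
  using cis_multiple_2pi[of "of_int (k * m)"] by (simp add: fourier_char_cis mult_ac)

lemma fourier_char_add_right: "fourier_char k (x + y) = fourier_char k x * fourier_char k y"
  by (simp add: fourier_char_cis cis_mult algebra_simps)

text \<open>Periodicity allows a measure on the line to be folded onto \<open>[0,1)\<close> by
  \<open>frac\<close> with its Fourier coefficients unchanged.\<close>

lemma fourier_char_frac: "fourier_char k (frac \<theta>) = fourier_char k \<theta>"
proof -
  have "fourier_char k (frac \<theta> + of_int \<lfloor>\<theta>\<rfloor>) = fourier_char k (frac \<theta>)"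
    unfolding fourier_char_add_right fourier_char_of_int by simp
  then show ?thesis by (simp add: frac_def)
qed

lemma continuous_on_fourier_char [continuous_intros]: "continuous_on S (fourier_char k)"
  unfolding fourier_char_def by (intro continuous_intros)

lemma borel_measurable_fourier_char [measurable]: "fourier_char k \<in> borel_measurable borel"
  by (intro borel_measurable_continuous_onI continuous_on_fourier_char)

lemma fourier_char_1_inj:
  assumes "x \<in> {0..<1}" "y \<in> {0..<1}" "fourier_char 1 x = fourier_char 1 y"
  shows "x = y"
proof -
  have "cis (2 * pi * x) = cis (2 * pi * y)"
    using assms(3) by (simp add: fourier_char_cis)
  then obtain n :: int where "2 * pi * x = 2 * pi * y + 2 * pi * n"
    using sin_cos_eq_iff[of "2 * pi * x" "2 * pi * y"] by (auto simp: complex_eq_iff)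
  then have "2 * pi * (x - y - n) = 0"
    by (simp add: algebra_simps)
  then have *: "x - y = n" by simp
  with assms have "real_of_int n < 1" "- 1 < real_of_int n" by auto
  then have "n = 0" by linarith
  with * show ?thesis by simp
qed

lemma space_circle_lebesgue [simp]: "space circle_lebesgue = {0..<1}"
  by (simp add: circle_lebesgue_def space_restrict_space)

lemma sets_circle_lebesgue: "sets circle_lebesgue = sets (restrict_space borel {0..<1})"
  unfolding circle_lebesgue_def by (rule sets_restrict_space_cong) simp

lemma prob_space_circle_lebesgue: "prob_space circle_lebesgue"
  by (rule prob_spaceI) (simp add: circle_lebesgue_def emeasure_restrict_space space_restrict_space)

lemma measurable_circle:
  assumes "sets M = sets circle_lebesgue" "f \<in> borel_measurable borel"
  shows "f \<in> borel_measurable M"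
proof -
  have "f \<in> borel_measurable (restrict_space borel {0..<1})"
    using assms(2) by (rule measurable_restrict_space1)
  then show ?thesis
    using measurable_cong_sets[OF assms(1)[unfolded sets_circle_lebesgue] refl] by blast
qed

lemma integrable_circle:
  fixes f :: "real \<Rightarrow> 'a::{banach, second_countable_topology}"
  assumes "finite_measure M" "sets M = sets circle_lebesgue" "f \<in> borel_measurable borel"
    and "\<And>\<theta>. norm (f \<theta>) \<le> B"
  shows "integrable M f"
  by (rule finite_measure.integrable_const_bound[OF assms(1) AE_I2])
     (use assms measurable_circle in blast)+

lemma integral_circle_lebesgue_fourier_char:
  "(LINT \<theta>|circle_lebesgue. fourier_char k \<theta>) = (if k = 0 then 1 else 0)"
proof (cases "k = 0")
  case True
  interpret prob_space circle_lebesgue by (rule prob_space_circle_lebesgue)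
  show ?thesis using True prob_space by simp
next
  case False
  define c where "c = 2 * of_real pi * \<i> * complex_of_int k"
  have c: "c \<noteq> 0" using False by (simp add: c_def)
  have "(LINT \<theta>|circle_lebesgue. fourier_char k \<theta>) = (LBINT \<theta>:{0..<1}. fourier_char k \<theta>)"
    unfolding circle_lebesgue_def
    by (subst integral_restrict_space) (auto simp: set_lebesgue_integral_def)
  also have "\<dots> = (LBINT \<theta>:{0..1}. fourier_char k \<theta>)"
    unfolding set_lebesgue_integral_def
  proof (intro integral_cong_AE)
    show "AE \<theta> in lborel. indicator {0..<1} \<theta> *\<^sub>R fourier_char k \<theta> = indicator {0..1} \<theta> *\<^sub>R fourier_char k \<theta>"
      using AE_lborel_singleton[of 1] by eventually_elim (auto simp: indicator_def)
  qed auto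
  also have "\<dots> = (\<integral>\<theta>. indicator {0..1} \<theta> *\<^sub>R fourier_char k \<theta> \<partial>lborel)"
    by (simp add: set_lebesgue_integral_def)
  also have "\<dots> = exp (c * of_real 1) / c - exp (c * of_real 0) / c"
  proof (rule integral_FTC_Icc)
    fix x :: real
    show "((\<lambda>x. exp (c * of_real x) / c) has_vector_derivative fourier_char k x) (at x within {0..1})"
      unfolding fourier_char_def c_def[symmetric] using c
      by (auto intro!: derivative_eq_intros has_vector_derivative_real_field simp: field_simps)
  qed (auto intro: continuous_on_fourier_char)
  also have "exp (c * of_real 1) = 1"
    using fourier_char_of_int[of k 1] by (simp add: fourier_char_def c_def)
  finally show ?thesis using False by simp
qed

section \<open>Trigonometric polynomials and uniqueness of a measure with given Fourier
  coefficients\<close>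

text \<open>Only sums of characters are generated, so that integrals are determined by Fourier
  coefficients; closure under products is derived in \<open>trig_poly_mult\<close>.\<close>

inductive trig_poly :: "(real \<Rightarrow> complex) \<Rightarrow> bool" where
  char: "trig_poly (\<lambda>\<theta>. c * fourier_char k \<theta>)"
| add: "trig_poly f \<Longrightarrow> trig_poly g \<Longrightarrow> trig_poly (\<lambda>\<theta>. f \<theta> + g \<theta>)"

lemma trig_poly_mult:
  assumes "trig_poly f" "trig_poly g"
  shows "trig_poly (\<lambda>\<theta>. f \<theta> * g \<theta>)"
  using assms(1)
proof induction
  case f: (char c k)
  show ?case
    using assms(2)
  proof induction
    case (char d l)
    show ?case
      using trig_poly.char[of "c * d" "k + l"] by (simp add: fourier_char_add mult_ac)
  qed (auto simp: distrib_left intro: trig_poly.add)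
qed (auto simp: distrib_right intro: trig_poly.add)

text \<open>On the unit circle \<open>cnj z\<close> is the character of frequency -1, so
  \<open>Re z\<close> and \<open>Im z\<close>, hence all real linear forms, combine the frequencies
  1 and -1. Sums and products then give all polynomials.\<close>

lemma trig_poly_real_polynomial:
  assumes "real_polynomial_function p"
  shows "trig_poly (\<lambda>\<theta>. of_real (p (fourier_char 1 \<theta>)))"
  using assms
proof induction
  case (linear f)
  have eq: "complex_of_real (f (fourier_char 1 \<theta>)) =
    (of_real (f 1) - \<i> * of_real (f \<i>)) / 2 * fourier_char 1 \<theta> +
    (of_real (f 1) + \<i> * of_real (f \<i>)) / 2 * fourier_char (- 1) \<theta>" for \<theta>
  proof -
    define z where "z = fourier_char 1 \<theta>"
    interpret f: bounded_linear f by fact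
    have "z = Re z *\<^sub>R 1 + Im z *\<^sub>R \<i>" by (simp add: complex_eq_iff)
    then have "f z = f (Re z *\<^sub>R 1 + Im z *\<^sub>R \<i>)" by simp
    also have "\<dots> = Re z * f 1 + Im z * f \<i>" unfolding f.add f.scaleR by simp
    finally show ?thesis
      unfolding fourier_char_minus z_def[symmetric] by (simp add: complex_eq_iff field_simps)
  qed
  show ?case unfolding eq by (intro trig_poly.intros)
next
  case (const c)
  show ?case using trig_poly.char[of "of_real c" 0] by simp
next
  case (add f g)
  then show ?case by (auto intro: trig_poly.add)
next
  case (mult f g)
  then show ?case by (auto intro: trig_poly_mult)
qed

lemma integral_trig_poly_eq:
  assumes fin: "finite_measure M" "finite_measure N"
    and sets: "sets M = sets circle_lebesgue" "sets N = sets circle_lebesgue"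
    and eq: "\<And>k. (LINT \<theta>|M. fourier_char k \<theta>) = (LINT \<theta>|N. fourier_char k \<theta>)"
    and "trig_poly f"
  shows "integrable M f \<and> integrable N f \<and> integral\<^sup>L M f = integral\<^sup>L N f"
  using \<open>trig_poly f\<close>
proof induction
  case (char c k)
  have "integrable L (fourier_char k)" if "finite_measure L" "sets L = sets circle_lebesgue" for L
    by (rule integrable_circle[OF that, where B = 1]) auto
  with fin sets show ?case by (auto simp: eq)
qed auto

text \<open>Composition with \<open>fourier_char 1\<close> encodes continuity on the circle,
  including across the glued endpoint of \<open>[0,1)\<close>. By Stone--Weierstrass
  \<open>g\<close> is within \<open>e\<close> of a polynomial on the unit circle, which moves each
  integral by at most \<open>e\<close> times the total mass.\<close>

lemma integral_circle_continuous_eq: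
  fixes g :: "complex \<Rightarrow> real"
  assumes fin: "finite_measure M" "finite_measure N"
    and sets: "sets M = sets circle_lebesgue" "sets N = sets circle_lebesgue"
    and eq: "\<And>k. (LINT \<theta>|M. fourier_char k \<theta>) = (LINT \<theta>|N. fourier_char k \<theta>)"
    and g: "continuous_on UNIV g" "\<And>z. \<bar>g z\<bar> \<le> B"
  shows "(LINT \<theta>|M. g (fourier_char 1 \<theta>)) = (LINT \<theta>|N. g (fourier_char 1 \<theta>))"
proof -
  let ?m = "measure M (space M) + measure N (space N)"
  have meas: "(\<lambda>\<theta>. g (fourier_char 1 \<theta>)) \<in> borel_measurable borel"
    by (intro borel_measurable_continuous_onI continuous_on_compose2[OF g(1)] continuous_intros) auto
  have bound: "\<bar>(LINT \<theta>|M. g (fourier_char 1 \<theta>)) - (LINT \<theta>|N. g (fourier_char 1 \<theta>))\<bar> \<le> e * ?m" if e: "0 < e" for e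
  proof -
    obtain p where p: "real_polynomial_function p"
      "\<And>z. z \<in> sphere 0 1 \<Longrightarrow> \<bar>g z - p z\<bar> < e"
      by (rule Stone_Weierstrass_real_polynomial_function[OF compact_sphere
            continuous_on_subset[OF g(1) subset_UNIV] e]) blast
    note P = integral_trig_poly_eq[OF fin sets eq trig_poly_real_polynomial[OF p(1)]]
    have *: "integrable M (\<lambda>\<theta>. p (fourier_char 1 \<theta>))" "integrable N (\<lambda>\<theta>. p (fourier_char 1 \<theta>))"
      "(LINT \<theta>|M. p (fourier_char 1 \<theta>)) = (LINT \<theta>|N. p (fourier_char 1 \<theta>))"
      using P by (auto simp: complex_of_real_integrable_eq)
    have close: "\<bar>(LINT \<theta>|L. g (fourier_char 1 \<theta>)) - (LINT \<theta>|L. p (fourier_char 1 \<theta>))\<bar> \<le> e * measure L (space L)"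
      if L: "finite_measure L" "sets L = sets circle_lebesgue" "integrable L (\<lambda>\<theta>. p (fourier_char 1 \<theta>))" for L
    proof -
      interpret finite_measure L by fact
      have gi: "integrable L (\<lambda>\<theta>. g (fourier_char 1 \<theta>))"
        using integrable_circle[OF L(1,2) meas] g(2) by auto
      have "\<bar>(LINT \<theta>|L. g (fourier_char 1 \<theta>)) - (LINT \<theta>|L. p (fourier_char 1 \<theta>))\<bar>
          = \<bar>LINT \<theta>|L. g (fourier_char 1 \<theta>) - p (fourier_char 1 \<theta>)\<bar>"
        using gi L(3) by simp
      also have "\<dots> \<le> (LINT \<theta>|L. \<bar>g (fourier_char 1 \<theta>) - p (fourier_char 1 \<theta>)\<bar>)"
        by (rule integral_abs_bound)
      also have "\<dots> \<le> (LINT \<theta>|L. e)"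
        using gi L(3) p(2) by (intro integral_mono) (auto intro: less_imp_le)
      finally show ?thesis by (simp add: mult.commute)
    qed
    show ?thesis
      using close[OF fin(1) sets(1) *(1)] close[OF fin(2) sets(2) *(2)] *(3)
      unfolding distrib_left by linarith
  qed
  have "\<bar>(LINT \<theta>|M. g (fourier_char 1 \<theta>)) - (LINT \<theta>|N. g (fourier_char 1 \<theta>))\<bar> \<le> 0"
  proof (rule field_le_epsilon)
    fix d :: real assume "0 < d"
    \<comment> \<open>The \<open>+ 1\<close> keeps the denominator positive even if both measures
      vanish.\<close>
    have *: "0 < d / (m + 1)" "d / (m + 1) * m \<le> d" if "0 \<le> m" for m
      using \<open>0 < d\<close> that by (simp_all add: field_simps)
    have "0 \<le> ?m" by simp
    from *[OF this] bound[of "d / (?m + 1)"]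
    show "\<bar>(LINT \<theta>|M. g (fourier_char 1 \<theta>)) - (LINT \<theta>|N. g (fourier_char 1 \<theta>))\<bar> \<le> 0 + d"
      by linarith
  qed
  then show ?thesis by simp
qed

text \<open>The arc \<open>A\<close> is closed, so its indicator is the decreasing limit of the
  continuous functions \<open>g n\<close>; dominated convergence carries the equality of integrals
  over to the arc.\<close>

lemma measure_initial_segment_eq:
  assumes fin: "finite_measure M" "finite_measure N"
    and sets: "sets M = sets circle_lebesgue" "sets N = sets circle_lebesgue"
    and eq: "\<And>k. (LINT \<theta>|M. fourier_char k \<theta>) = (LINT \<theta>|N. fourier_char k \<theta>)"
    and a: "0 \<le> a" "a < 1"
  shows "measure M {0..a} = measure N {0..a}"
proof -
  define A where "A = fourier_char 1 ` {0..a}"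
  define g where "g n z = max 0 (1 - real n * infdist z A)" for n z
  have "compact A" unfolding A_def
    by (intro compact_continuous_image continuous_intros compact_Icc)
  then have "closed A" by (rule compact_imp_closed)
  moreover have "A \<noteq> {}" using a by (auto simp: A_def)
  ultimately have A: "infdist z A = 0 \<longleftrightarrow> z \<in> A" for z
    using in_closed_iff_infdist_zero by blast
  have g01: "\<bar>g n z\<bar> \<le> 1" for n z
    by (simp add: g_def infdist_nonneg)
  have g_cont: "continuous_on UNIV (g n)" for n
    unfolding g_def by (intro continuous_intros)
  have meas: "(\<lambda>\<theta>. g n (fourier_char 1 \<theta>)) \<in> borel_measurable borel" for n
    by (intro borel_measurable_continuous_onI continuous_on_compose2[OF g_cont] continuous_intros) auto
  have lim: "(\<lambda>n. g n z) \<longlonglongrightarrow> indicator A z" for z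
  proof (cases "z \<in> A")
    case True
    then have "infdist z A = 0" using A by simp
    with True show ?thesis by (simp add: g_def)
  next
    case False
    then have "0 < infdist z A" using A[of z] infdist_nonneg[of z A] by linarith
    then have "\<forall>\<^sub>F n in sequentially. 1 / infdist z A < real n"
      using filterlim_real_sequentially eventually_compose_filterlim eventually_gt_at_top by blast
    then have "\<forall>\<^sub>F n in sequentially. g n z = indicator A z"
      by eventually_elim (use False \<open>0 < infdist z A\<close> in \<open>auto simp: g_def field_simps\<close>)
    then show ?thesis by (rule tendsto_eventually)
  qed
  \<comment> \<open>Injectivity of \<open>fourier_char 1\<close> on \<open>[0,1)\<close> keeps
    points outside \<open>{0..a}\<close> from landing on the arc.\<close>
  have ind: "indicator A (fourier_char 1 \<theta>) = (indicator {0..a} \<theta> :: real)" if "\<theta> \<in> {0..<1}" for \<theta>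
    using fourier_char_1_inj[OF that] a by (force simp: A_def indicator_def)
  have conv: "(\<lambda>n. LINT \<theta>|L. g n (fourier_char 1 \<theta>)) \<longlonglongrightarrow> measure L {0..a}"
    if L: "finite_measure L" "sets L = sets circle_lebesgue" for L
  proof -
    interpret finite_measure L by fact
    have space: "space L = {0..<1}" using sets_eq_imp_space_eq[OF L(2)] by simp
    have [measurable]: "{0..a} \<in> sets L"
      using a unfolding L(2) sets_circle_lebesgue by (auto simp: sets_restrict_space intro!: image_eqI[of _ _ "{0..a}"])
    have "(\<lambda>n. LINT \<theta>|L. g n (fourier_char 1 \<theta>)) \<longlonglongrightarrow> (LINT \<theta>|L. indicator {0..a} \<theta>)"
    proof (rule integral_dominated_convergence[where w = "\<lambda>_. 1"])
      show "AE \<theta> in L. (\<lambda>n. g n (fourier_char 1 \<theta>)) \<longlonglongrightarrow> indicator {0..a} \<theta>"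
        using lim ind by (intro AE_I2) (metis space)
      show "(\<lambda>\<theta>. g n (fourier_char 1 \<theta>)) \<in> borel_measurable L" for n
        using L(2) meas by (rule measurable_circle)
    qed (use g01 in auto)
    moreover have "{0..a} \<inter> {0..<1} = {0..a}" using a by auto
    ultimately show ?thesis by (simp add: space)
  qed
  have "(\<lambda>n. LINT \<theta>|M. g n (fourier_char 1 \<theta>)) = (\<lambda>n. LINT \<theta>|N. g n (fourier_char 1 \<theta>))"
    using integral_circle_continuous_eq[OF fin sets eq g_cont g01] by blast
  then show ?thesis
    using conv[OF fin(1) sets(1)] conv[OF fin(2) sets(2)] LIMSEQ_unique by metis
qed

text \<open>Viewed on the line, finite measures are determined by their distribution functions.
  These agree below 1 by \<open>measure_initial_segment_eq\<close>, and from 1 on by the coefficient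
  at frequency 0, which is the total mass.\<close>

theorem circle_measure_eqI_fourier:
  assumes fin: "finite_measure M" "finite_measure N"
    and sets: "sets M = sets circle_lebesgue" "sets N = sets circle_lebesgue"
    and eq: "\<And>k. (LINT \<theta>|M. fourier_char k \<theta>) = (LINT \<theta>|N. fourier_char k \<theta>)"
  shows "M = N"
proof -
  define B where "B L = distr L borel (\<lambda>x::real. x)" for L
  have id: "(\<lambda>x. x) \<in> borel_measurable L" if "sets L = sets circle_lebesgue" for L :: "real measure"
    using that by (rule measurable_circle) simp
  have space: "space L = {0..<1}" if "sets L = sets circle_lebesgue" for L
    using sets_eq_imp_space_eq[OF that] by simp
  have fbm: "finite_borel_measure (B L)" if "finite_measure L" "sets L = sets circle_lebesgue" for L
    unfolding finite_borel_measure_def finite_borel_measure_axioms_def B_def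
    using finite_measure.finite_measure_distr[OF that(1) id[OF that(2)]] by simp
  have "measure M (space M) = measure N (space N)"
    using eq[of 0] by simp
  then have "measure M ({..x} \<inter> {0..<1}) = measure N ({..x} \<inter> {0..<1})" for x
  proof -
    consider "x < 0" | "0 \<le> x" "x < 1" | "1 \<le> x" by linarith
    then show ?thesis
    proof cases
      case 1
      then have "{..x} \<inter> {0..<1} = {}" by auto
      then show ?thesis by simp
    next
      case 2
      then have "{..x} \<inter> {0..<1} = {0..x}" by auto
      then show ?thesis using measure_initial_segment_eq[OF fin sets eq 2] by simp
    next
      case 3
      then have "{..x} \<inter> {0..<1} = {0..<1}" by auto
      then show ?thesis using eq[of 0] by (simp add: space[OF sets(1)] space[OF sets(2)])
    qed
  qed
  then have "cdf (B M) = cdf (B N)"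
    unfolding cdf_def B_def
    by (simp add: fun_eq_iff measure_distr id sets space vimage_def Int_def)
  then have "B M = B N"
    using cdf_unique'[OF fbm fbm] fin sets by blast
  show ?thesis
  proof (rule measure_eqI)
    fix A assume A: "A \<in> sets M"
    then have "A \<in> sets borel" "A \<subseteq> {0..<1}"
      unfolding sets(1) sets_circle_lebesgue by (auto simp: sets_restrict_space)
    then have "emeasure (B L) A = emeasure L A" if "sets L = sets circle_lebesgue" for L
      unfolding B_def using that by (simp add: emeasure_distr id space Int_absorb2)
    with \<open>B M = B N\<close> sets show "emeasure M A = emeasure N A" by metis
  qed (simp add: sets)
qed

section \<open>Existence of diffraction measures\<close>

text \<open>This is the periodogram of the first \<open>N\<close> weights: expanding the square
  yields the correlation sums of this finite block as Fourier coefficients.\<close>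

definition fejer_density :: "(nat \<Rightarrow> real) \<Rightarrow> nat \<Rightarrow> real \<Rightarrow> real" where
  "fejer_density w N \<theta> = (norm (\<Sum>n<N. w n * fourier_char n \<theta>))\<^sup>2 / N"

lemma borel_measurable_fejer_density [measurable]: "fejer_density w N \<in> borel_measurable borel"
  unfolding fejer_density_def by measurable

lemma fejer_density_nonneg: "0 \<le> fejer_density w N \<theta>"
  by (simp add: fejer_density_def)

lemma fejer_density_eq:
  "complex_of_real (fejer_density w N \<theta>) =
     (\<Sum>n<N. \<Sum>m<N. of_real (w n * w m / N) * fourier_char (int n - int m) \<theta>)"
proof -
  have "complex_of_real (fejer_density w N \<theta>) =
    (\<Sum>n<N. w n * fourier_char n \<theta>) * cnj (\<Sum>n<N. w n * fourier_char n \<theta>) / N"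
    by (simp only: fejer_density_def of_real_divide complex_norm_square of_real_of_nat_eq)
  then show ?thesis
    by (simp add: sum_product sum_divide_distrib fourier_char_diff mult_ac)
qed

lemma integrable_fourier_char_circle: "integrable circle_lebesgue (fourier_char k)"
  using integrable_circle[of circle_lebesgue "fourier_char k" 1] prob_space_circle_lebesgue
  by (auto intro: prob_space.finite_measure)

lemma fejer_density_fourier:
  "integrable circle_lebesgue (\<lambda>\<theta>. fejer_density w N \<theta> * fourier_char k \<theta>)"
  "(LINT \<theta>|circle_lebesgue. fejer_density w N \<theta> * fourier_char k \<theta>) =
     (\<Sum>n<N. \<Sum>m<N. if int m = int n + k then complex_of_real (w n * w m) else 0) / N"
proof -
  have eq: "(\<lambda>\<theta>. fejer_density w N \<theta> * fourier_char k \<theta>) =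
      (\<lambda>\<theta>. \<Sum>n<N. \<Sum>m<N. of_real (w n * w m / N) * fourier_char (int n - int m + k) \<theta>)"
    by (simp add: fejer_density_eq sum_distrib_left sum_distrib_right fourier_char_add mult_ac)
  show "integrable circle_lebesgue (\<lambda>\<theta>. fejer_density w N \<theta> * fourier_char k \<theta>)"
    unfolding eq by (intro Bochner_Integration.integrable_sum integrable_mult_right integrable_fourier_char_circle)
  have "(LINT \<theta>|circle_lebesgue. fejer_density w N \<theta> * fourier_char k \<theta>) =
      (\<Sum>n<N. \<Sum>m<N. of_real (w n * w m / N) * (if int n - int m + k = 0 then 1 else 0))"
    unfolding eq
    by (simp add: Bochner_Integration.integral_sum integrable_fourier_char_circle
        integral_circle_lebesgue_fourier_char del: of_real_mult of_real_divide)
  also have "\<dots> = (\<Sum>n<N. \<Sum>m<N. if int m = int n + k then complex_of_real (w n * w m) else 0) / N"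
    unfolding sum_divide_distrib by (intro sum.cong) auto
  finally show "(LINT \<theta>|circle_lebesgue. fejer_density w N \<theta> * fourier_char k \<theta>) =
     (\<Sum>n<N. \<Sum>m<N. if int m = int n + k then complex_of_real (w n * w m) else 0) / N" .
qed

text \<open>The square only sees pairs with both indices below \<open>N\<close>, whereas the mean
  lets \<open>n + k\<close> run past \<open>N\<close>; at most \<open>k\<close> terms of absolute
  value at most 1 differ.\<close>

lemma fejer_density_fourier_nat_close:
  assumes w: "\<And>n. \<bar>w n\<bar> \<le> 1"
  shows "norm ((LINT \<theta>|circle_lebesgue. fejer_density w N \<theta> * fourier_char (int k) \<theta>)
    - of_real (autocorrelation_mean w k N)) \<le> k / N"
proof -
  have "(\<Sum>n<N. \<Sum>m<N. if int m = int n + int k then of_real (w n * w m) else 0) =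
      (\<Sum>n<N. if n + k < N then of_real (w n * w (n + k)) else (0::complex))"
  proof (rule sum.cong)
    fix n
    have "(\<Sum>m<N. if int m = int n + int k then of_real (w n * w m) else 0) =
        (\<Sum>m<N. if m = n + k then of_real (w n * w (n + k)) else (0::complex))"
      by (intro sum.cong) auto
    then show "(\<Sum>m<N. if int m = int n + int k then of_real (w n * w m) else 0) =
        (if n + k < N then of_real (w n * w (n + k)) else (0::complex))"
      by simp
  qed simp
  then have "(LINT \<theta>|circle_lebesgue. fejer_density w N \<theta> * fourier_char (int k) \<theta>)
    - of_real (autocorrelation_mean w k N) =
    (\<Sum>n<N. (if n + k < N then 0 else - complex_of_real (w n * w (n + k)))) / N"
    unfolding fejer_density_fourier autocorrelation_mean_def
    by (simp add: diff_divide_distrib[symmetric] sum_subtractf[symmetric] if_distrib cong: if_cong)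
       (auto intro!: arg_cong2[where f = "(/)"] sum.cong)
  also have "norm \<dots> = norm (\<Sum>n<N. if n + k < N then 0 else - complex_of_real (w n * w (n + k))) / N"
    by (simp add: norm_divide)
  also have "\<dots> \<le> k / N"
  proof (rule divide_right_mono)
    have "norm (\<Sum>n<N. if n + k < N then 0 else - complex_of_real (w n * w (n + k))) \<le>
        (\<Sum>n<N. if n \<in> {N - k..<N} then 1 else 0)"
    proof (rule sum_norm_le)
      fix n assume "n \<in> {..<N}"
      moreover have "\<bar>w n * w (n + k)\<bar> \<le> 1"
        unfolding abs_mult using w by (intro mult_le_one) auto
      ultimately show "norm (if n + k < N then 0 else - complex_of_real (w n * w (n + k))) \<le>
          (if n \<in> {N - k..<N} then 1 else 0)"
        by (auto simp del: of_real_mult)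
    qed
    also have "\<dots> = real (card ({..<N} \<inter> {N - k..<N}))"
      by (subst sum.If_cases) (auto intro!: arg_cong[where f = card])
    also have "\<dots> \<le> real (card {N - k..<N})"
      by (intro of_nat_mono card_mono) auto
    also have "\<dots> \<le> k" by simp
    finally show "norm (\<Sum>n<N. if n + k < N then 0 else - complex_of_real (w n * w (n + k))) \<le> k" .
  qed simp
  finally show ?thesis .
qed

lemma fejer_density_fourier_tendsto:
  assumes w: "\<And>n. \<bar>w n\<bar> \<le> 1" and "convergent (autocorrelation_mean w k)"
  shows "(\<lambda>N. LINT \<theta>|circle_lebesgue. fejer_density w N \<theta> * fourier_char (int k) \<theta>)
    \<longlonglongrightarrow> of_real (autocorrelation w (int k))"
proof -
  have "autocorrelation_mean w k \<longlonglongrightarrow> autocorrelation w (int k)"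
    using assms(2) by (simp add: autocorrelation_def convergent_LIMSEQ_iff)
  then have "(\<lambda>N. complex_of_real (autocorrelation_mean w k N)) \<longlonglongrightarrow> of_real (autocorrelation w (int k))"
    by (rule tendsto_of_real)
  moreover have "(\<lambda>N. (LINT \<theta>|circle_lebesgue. fejer_density w N \<theta> * fourier_char (int k) \<theta>)
    - of_real (autocorrelation_mean w k N)) \<longlonglongrightarrow> 0"
    by (rule Lim_null_comparison[OF always_eventually lim_const_over_n[of "real k"]])
       (intro allI fejer_density_fourier_nat_close w)
  ultimately show ?thesis
    by (rule Lim_transform)
qed

section \<open>Herglotz's theorem by weak compactness\<close>

text \<open>Since \<open>\<bar>w n\<bar> = 1\<close>, the periodograms are probability densities. As
  measures on the line they all live on \<open>[0,1)\<close>, hence are tight, and a weak limit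
  along a subsequence inherits the limits of their Fourier coefficients.\<close>

theorem diffraction_measure_exists:
  assumes w: "\<And>n. \<bar>w n\<bar> = 1" and conv: "\<And>k. convergent (autocorrelation_mean w k)"
  shows "\<exists>\<sigma>. is_diffraction_measure w \<sigma>"
proof -
  \<comment> \<open>\<open>Suc N\<close> excludes the index 0, where the density vanishes and the
    mass would not be 1.\<close>
  define D where "D N = density circle_lebesgue (\<lambda>\<theta>. ennreal (fejer_density w (Suc N) \<theta>))" for N
  define \<mu> where "\<mu> N = distr (D N) borel (\<lambda>x. x)" for N
  have circle_meas: "f \<in> borel_measurable circle_lebesgue"
    if "f \<in> borel_measurable borel" for f :: "real \<Rightarrow> 'b::topological_space"
    using that by (rule measurable_circle[OF refl])
  have id: "(\<lambda>x. x) \<in> measurable (D N) borel" for N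
    using circle_meas[of "\<lambda>x. x"] by (simp add: D_def)
  have \<mu>_integral: "integral\<^sup>L (\<mu> N) f = (LINT \<theta>|circle_lebesgue. fejer_density w (Suc N) \<theta> * f \<theta>)"
    if "f \<in> borel_measurable borel" for f :: "real \<Rightarrow> complex" and N
    unfolding \<mu>_def integral_distr[OF id that] unfolding D_def
    by (subst integral_density)
       (use that in \<open>auto intro!: circle_meas fejer_density_nonneg simp: scaleR_conv_of_real\<close>)
  have mass: "emeasure (D N) {0..<1} = 1" for N
  proof -
    have "(\<Sum>n<Suc N. \<Sum>m<Suc N. if int m = int n + 0 then of_real (w n * w m) else 0) =
        (\<Sum>n<Suc N. 1::complex)" (is "?S = _")
    proof (rule sum.cong)
      fix n assume "n \<in> {..<Suc N}"
      have "w n * w n = 1" using w[of n] by (metis abs_mult_self_eq mult_1)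
      moreover have "(\<Sum>m<Suc N. if int m = int n + 0 then of_real (w n * w m) else 0) =
          (\<Sum>m<Suc N. if m = n then of_real (w n * w n) else (0::complex))"
        by (intro sum.cong) auto
      ultimately show "(\<Sum>m<Suc N. if int m = int n + 0 then of_real (w n * w m) else 0) = (1::complex)"
        using \<open>n \<in> {..<Suc N}\<close> by (simp del: of_real_mult sum.lessThan_Suc)
    qed simp
    then have "?S / of_nat (Suc N) = 1"
      by (simp del: of_nat_Suc sum.lessThan_Suc)
    then have "(LINT \<theta>|circle_lebesgue. complex_of_real (fejer_density w (Suc N) \<theta>)) = 1"
      using fejer_density_fourier(2)[of w "Suc N" 0] unfolding fourier_char_0 mult_1_right
      by (rule trans[rotated])
    then have "(LINT \<theta>|circle_lebesgue. fejer_density w (Suc N) \<theta>) = 1"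
      by simp
    moreover have "integrable circle_lebesgue (fejer_density w (Suc N))"
      using fejer_density_fourier(1)[of w "Suc N" 0] by (simp add: complex_of_real_integrable_eq)
    ultimately have "(\<integral>\<^sup>+\<theta>. ennreal (fejer_density w (Suc N) \<theta>) \<partial>circle_lebesgue) = 1"
      by (simp add: nn_integral_eq_integral fejer_density_nonneg)
    moreover have "emeasure (D N) (space circle_lebesgue) = (\<integral>\<^sup>+\<theta>. ennreal (fejer_density w (Suc N) \<theta>) \<partial>circle_lebesgue)"
      unfolding D_def
      by (subst emeasure_density[OF _ sets.top]) (auto intro!: circle_meas nn_integral_cong split: split_indicator)
    ultimately show ?thesis by simp
  qed
  have space_D: "space (D N) = {0..<1}" for N by (simp add: D_def)
  have em: "emeasure (\<mu> N) {-1<..1} = 1" for N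
  proof -
    have "{-1<..1} \<inter> {0..<1} = {0..<1::real}" by auto
    then show ?thesis
      unfolding \<mu>_def by (subst emeasure_distr[OF id]) (simp_all add: space_D mass)
  qed
  have rd: "real_distribution (\<mu> N)" for N
  proof -
    have "prob_space (D N)" by (rule prob_spaceI) (simp add: space_D mass)
    then show ?thesis
      unfolding \<mu>_def real_distribution_def real_distribution_axioms_def
      using prob_space.prob_space_distr id by auto
  qed
  have "tight \<mu>"
    unfolding tight_def
  proof (intro conjI allI impI rd)
    fix e :: real assume "0 < e"
    then show "\<exists>a b. a < b \<and> (\<forall>N. 1 - e < measure (\<mu> N) {a<..b})"
      using em by (intro exI[of _ "-1"] exI[of _ 1]) (simp add: measure_def)
  qed
  then obtain r M where r: "strict_mono r" and M: "real_distribution M"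
    and weak: "weak_conv_m (\<mu> \<circ> id \<circ> r) M"
    using tight_imp_convergent_subsubsequence[of \<mu> id] strict_mono_id by blast
  interpret M: real_distribution M by (rule M)
  have M_nat: "(LINT \<theta>|M. fourier_char (int k) \<theta>) = of_real (autocorrelation w (int k))" for k
  proof (rule LIMSEQ_unique)
    have "isCont (fourier_char (int k)) x" for x
      using continuous_on_fourier_char[of UNIV] by (simp add: continuous_on_eq_continuous_at)
    then show "(\<lambda>N. integral\<^sup>L ((\<mu> \<circ> id \<circ> r) N) (fourier_char (int k))) \<longlonglongrightarrow> (LINT \<theta>|M. fourier_char (int k) \<theta>)"
      using weak rd M by (intro weak_conv_imp_integral_bdd_continuous_conv[where B = 1]) (auto simp: o_def)
    have "filterlim (\<lambda>N. Suc (r N)) at_top at_top"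
      using r by (intro filterlim_compose[OF filterlim_Suc] filterlim_subseq)
    from filterlim_compose[OF fejer_density_fourier_tendsto[OF _ conv[of k]] this]
    show "(\<lambda>N. integral\<^sup>L ((\<mu> \<circ> id \<circ> r) N) (fourier_char (int k))) \<longlonglongrightarrow> of_real (autocorrelation w (int k))"
      using w by (simp add: \<mu>_integral)
  qed
  \<comment> \<open>Negative frequencies follow by conjugation, since the autocorrelation is real
    and even.\<close>
  have M_int: "(LINT \<theta>|M. fourier_char k \<theta>) = of_real (autocorrelation w k)" for k
  proof (cases "0 \<le> k")
    case True
    then show ?thesis using M_nat[of "nat k"] by simp
  next
    case False
    then have "fourier_char k \<theta> = cnj (fourier_char (int (nat (- k))) \<theta>)" for \<theta>
      by (simp flip: fourier_char_minus)
    then show ?thesis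
      using M_nat[of "nat (- k)"] False by (simp add: autocorrelation_def)
  qed
  \<comment> \<open>In the weak limit mass may reach the endpoint 1, which lies outside
    \<open>[0,1)\<close>; \<open>frac\<close> moves it to 0.\<close>
  define \<sigma> where "\<sigma> = distr M (restrict_space borel {0..<1}) frac"
  have frac: "frac \<in> measurable M (restrict_space borel {0..<1})"
  proof (rule measurable_restrict_space2)
    show "frac \<in> measurable M borel"
      unfolding frac_def by measurable
  qed (auto simp: frac_lt_1)
  have "(LINT \<theta>|\<sigma>. fourier_char k \<theta>) = of_real (autocorrelation w k)" for k
    unfolding \<sigma>_def
    by (subst integral_distr[OF frac]) (auto simp: fourier_char_frac M_int intro: measurable_restrict_space1)
  moreover have "finite_measure \<sigma>"
    unfolding \<sigma>_def using frac by (rule M.finite_measure_distr)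
  ultimately have "is_diffraction_measure w \<sigma>"
    unfolding is_diffraction_measure_def
    using conv by (simp add: \<sigma>_def sets_circle_lebesgue fourier_char_def)
  then show ?thesis ..
qed

theorem is_diffraction_measure_diffraction_measure:
  assumes "\<And>n. \<bar>w n\<bar> = 1" "\<And>k. convergent (autocorrelation_mean w k)"
  shows "is_diffraction_measure w (diffraction_measure w)"
proof -
  have "\<sigma> = \<tau>" if "is_diffraction_measure w \<sigma>" "is_diffraction_measure w \<tau>" for \<sigma> \<tau>
    using that unfolding is_diffraction_measure_def fourier_char_def[symmetric]
    by (intro circle_measure_eqI_fourier) metis+
  with diffraction_measure_exists[OF assms] have "\<exists>!\<sigma>. is_diffraction_measure w \<sigma>"
    by blast
  then show ?thesis
    unfolding diffraction_measure_def by (rule theI')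
qed

section \<open>Absence of atoms\<close>

text \<open>The terms are powers of a unimodular \<open>q\<close>. For \<open>q = 1\<close> their
  average is 1; otherwise the geometric sum stays bounded by
  \<open>2 / norm (q - 1)\<close>.\<close>

lemma fourier_char_average_tendsto:
  assumes "\<theta> \<in> {0..<1}" "t \<in> {0..<1}"
  shows "(\<lambda>N. (\<Sum>k<N. fourier_char (int k) \<theta> * cnj (fourier_char (int k) t)) / of_nat N)
    \<longlonglongrightarrow> (if \<theta> = t then 1 else 0)"
proof -
  define q where "q = fourier_char 1 \<theta> * cnj (fourier_char 1 t)"
  have q: "fourier_char (int k) \<theta> * cnj (fourier_char (int k) t) = q ^ k" for k
    by (simp add: q_def fourier_char_of_nat power_mult_distrib)
  show ?thesis
  proof (cases "\<theta> = t")
    case True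
    then have "q = 1"
      by (simp add: q_def complex_norm_square[symmetric])
    have "\<forall>\<^sub>F N in sequentially. (\<Sum>k<N. q ^ k) / of_nat N = 1"
      using eventually_gt_at_top[of 0] by eventually_elim (simp add: \<open>q = 1\<close>)
    then show ?thesis
      unfolding q using True by (simp add: tendsto_eventually)
  next
    case False
    have "q \<noteq> 1"
    proof
      assume "q = 1"
      then have "fourier_char 1 \<theta> * (cnj (fourier_char 1 t) * fourier_char 1 t) = fourier_char 1 t"
        by (simp add: q_def mult.assoc[symmetric])
      moreover have "cnj (fourier_char 1 t) * fourier_char 1 t = 1"
        using complex_norm_square[of "fourier_char 1 t"] by (simp add: mult.commute)
      ultimately have "fourier_char 1 \<theta> = fourier_char 1 t" by simp
      with fourier_char_1_inj assms False show False by blast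
    qed
    have "norm q = 1" by (simp add: q_def norm_mult)
    have le: "norm ((\<Sum>k<N. q ^ k) / of_nat N) \<le> (2 / norm (q - 1)) / N" for N
    proof -
      have "norm (q ^ N - 1) \<le> norm (q ^ N) + norm (1::complex)"
        by (rule norm_triangle_ineq4)
      then have "norm (q ^ N - 1) \<le> 2"
        using \<open>norm q = 1\<close> by (simp add: norm_power)
      then show ?thesis
        using \<open>q \<noteq> 1\<close> by (simp add: geometric_sum norm_divide norm_mult divide_right_mono)
    qed
    then show ?thesis
      unfolding q using False
      by (simp add: Lim_null_comparison[OF always_eventually[OF allI[OF le]] lim_const_over_n])
  qed
qed

lemma norm_fourier_char_average_le:
  "norm ((\<Sum>k<N. fourier_char (int k) \<theta> * cnj (fourier_char (int k) t)) / of_nat N) \<le> 1"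
proof -
  have "norm (\<Sum>k<N. fourier_char (int k) \<theta> * cnj (fourier_char (int k) t)) \<le> of_nat (card {..<N}) * 1"
    by (rule sum_norm_bound) (simp add: norm_mult)
  then show ?thesis
    by (cases "N = 0") (simp_all add: norm_divide)
qed

text \<open>Under the integral stand averages that converge boundedly to the indicator of
  \<open>{t}\<close>, so dominated convergence applies.\<close>

lemma measure_singleton_fourier:
  assumes fin: "finite_measure M" and sets: "sets M = sets circle_lebesgue" and t: "t \<in> {0..<1}"
  shows "(\<lambda>N. (\<Sum>k<N. (LINT \<theta>|M. fourier_char (int k) \<theta>) * cnj (fourier_char (int k) t)) / of_nat N)
    \<longlonglongrightarrow> of_real (measure M {t})"
proof -
  interpret finite_measure M by fact
  have space: "space M = {0..<1}" using sets_eq_imp_space_eq[OF sets] by simp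
  have [measurable]: "{t} \<in> sets M"
    using t unfolding sets sets_circle_lebesgue
    by (auto simp: sets_restrict_space intro!: image_eqI[of _ _ "{t}"])
  have meas: "f \<in> borel_measurable M" if "f \<in> borel_measurable borel" for f :: "real \<Rightarrow> complex"
    using sets that by (rule measurable_circle)
  have int: "integrable M (fourier_char k)" for k
    by (rule integrable_circle[OF fin sets, where B = 1]) auto
  have "(\<lambda>N. LINT \<theta>|M. (\<Sum>k<N. fourier_char (int k) \<theta> * cnj (fourier_char (int k) t)) / of_nat N)
    \<longlonglongrightarrow> (LINT \<theta>|M. indicator {t} \<theta>)"
  proof (rule integral_dominated_convergence[where w = "\<lambda>_. 1"])
    show "AE \<theta> in M. (\<lambda>N. (\<Sum>k<N. fourier_char (int k) \<theta> * cnj (fourier_char (int k) t)) / of_nat N)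
      \<longlonglongrightarrow> indicator {t} \<theta>"
    proof (rule AE_I2)
      fix \<theta> assume "\<theta> \<in> space M"
      then have "\<theta> \<in> {0..<1}" by (simp add: space)
      have "indicator {t} \<theta> = (if \<theta> = t then 1 else 0 :: complex)"
        by (simp add: indicator_def)
      with fourier_char_average_tendsto[OF \<open>\<theta> \<in> {0..<1}\<close> t]
      show "(\<lambda>N. (\<Sum>k<N. fourier_char (int k) \<theta> * cnj (fourier_char (int k) t)) / of_nat N)
        \<longlonglongrightarrow> indicator {t} \<theta>"
        by simp
    qed
  qed (use norm_fourier_char_average_le in \<open>auto intro!: meas\<close>)
  moreover have "(LINT \<theta>|M. indicator {t} \<theta> :: complex) = of_real (measure M {t})"
  proof -
    have "(LINT \<theta>|M. indicator {t} \<theta> :: complex) = (LINT \<theta>|M. of_real (indicator {t} \<theta>))"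
      by (intro Bochner_Integration.integral_cong) (auto simp: indicator_def)
    also have "{t} \<inter> space M = {t}" using t space by auto
    ultimately show ?thesis by simp
  qed
  moreover have "(LINT \<theta>|M. (\<Sum>k<N. fourier_char (int k) \<theta> * cnj (fourier_char (int k) t)) / of_nat N) =
      (\<Sum>k<N. (LINT \<theta>|M. fourier_char (int k) \<theta>) * cnj (fourier_char (int k) t)) / of_nat N" for N
    by (simp add: Bochner_Integration.integral_sum int)
  ultimately show ?thesis by (simp only:)
qed

text \<open>
  After one step the sum of squares could double; after two steps the factor \<open>9/4 + 5/4 = 7/2\<close>
  stays below 4, which gives decay of the quadratic means.
\<close>

lemma rsl_corr_quadruple:
  "(norm (rsl_corr (4 * k)))\<^sup>2 + (norm (rsl_corr (4 * k + 1)))\<^sup>2 +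
   (norm (rsl_corr (4 * k + 2)))\<^sup>2 + (norm (rsl_corr (4 * k + 3)))\<^sup>2 \<le>
   9 / 4 * (norm (rsl_corr k))\<^sup>2 + 5 / 4 * (norm (rsl_corr (k + 1)))\<^sup>2"
proof -
  define a b where "a = rsl_corr k" and "b = rsl_corr (k + 1)"
  have 2: "rsl_corr (2 * k) = cnj a" "rsl_corr (2 * k + 1) = \<i> / 2 * (cnj a - cnj b)" "rsl_corr (2 * k + 2) = cnj b"
    using rsl_corr_double[of k] rsl_corr_double_Suc[of k] rsl_corr_double[of "k + 1"] by (auto simp: a_def b_def)
  have 4: "rsl_corr (4 * k) = a" "rsl_corr (4 * k + 1) = \<i> / 2 * (a - - \<i> / 2 * (a - b))"
      "rsl_corr (4 * k + 2) = - \<i> / 2 * (a - b)" "rsl_corr (4 * k + 3) = \<i> / 2 * (- \<i> / 2 * (a - b) - b)"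
  proof -
    have idx: "4 * k = 2 * (2 * k)" "2 * (2 * k) + 2 = 2 * (2 * k + 1)"
        "2 * (2 * k) + 3 = 2 * (2 * k + 1) + 1" "2 * k + 1 + 1 = 2 * k + 2"
      by simp_all
    show "rsl_corr (4 * k) = a"
      unfolding idx rsl_corr_double[of "2 * k"] 2 by simp
    show "rsl_corr (4 * k + 1) = \<i> / 2 * (a - - \<i> / 2 * (a - b))"
      unfolding idx rsl_corr_double_Suc[of "2 * k"] 2 by simp
    show "rsl_corr (4 * k + 2) = - \<i> / 2 * (a - b)"
      unfolding idx(1) unfolding idx(2) rsl_corr_double[of "2 * k + 1"] 2 by simp
    show "rsl_corr (4 * k + 3) = \<i> / 2 * (- \<i> / 2 * (a - b) - b)"
      unfolding idx(1) unfolding idx(3) rsl_corr_double_Suc[of "2 * k + 1"] idx(4) 2 by simp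
  qed
  \<comment> \<open>The two added squares cancel the cross terms in \<open>Re (a * cnj b)\<close>,
    with coefficient \<open>- 3 / 4\<close>, and in \<open>Im (a * cnj b)\<close>, with coefficient
    \<open>- 1 / 2\<close>.\<close>
  have "(norm (rsl_corr (4 * k)))\<^sup>2 + (norm (rsl_corr (4 * k + 1)))\<^sup>2 +
      (norm (rsl_corr (4 * k + 2)))\<^sup>2 + (norm (rsl_corr (4 * k + 3)))\<^sup>2 +
      (3 / 8 * (norm (a + b))\<^sup>2 + 1 / 4 * (norm (a + \<i> * b))\<^sup>2) =
      9 / 4 * (norm a)\<^sup>2 + 5 / 4 * (norm b)\<^sup>2"
    unfolding 4 cmod_power2 by (simp add: power2_eq_square field_simps)
  moreover have "0 \<le> 3 / 8 * (norm (a + b))\<^sup>2 + 1 / 4 * (norm (a + \<i> * b))\<^sup>2"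
    by simp
  ultimately show ?thesis
    unfolding a_def[symmetric] b_def[symmetric] by linarith
qed

section \<open>Decay of the means of the autocorrelation\<close>

lemma sum_lessThan_quadruple:
  fixes f :: "nat \<Rightarrow> real"
  shows "(\<Sum>k<4 * N. f k) = (\<Sum>k<N. f (4 * k) + f (4 * k + 1) + f (4 * k + 2) + f (4 * k + 3))"
  by (induction N) (auto simp: numeral_eq_Suc)

lemma sum_norm_rsl_corr_square: "(\<Sum>k<4 ^ n. (norm (rsl_corr k))\<^sup>2) \<le> (7 / 2) ^ n"
proof (induction n)
  case (Suc n)
  define f where "f k = (norm (rsl_corr k))\<^sup>2" for k
  \<comment> \<open>Shifting trades the term at 0, which is 1, for the one at \<open>N\<close>,
    which is at most 1.\<close>
  have shift: "(\<Sum>k<N. f (k + 1)) \<le> (\<Sum>k<N. f k)" for N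
  proof -
    have "(\<Sum>k<N. f (k + 1)) + f 0 = (\<Sum>k<N. f k) + f N"
      by (induction N) auto
    moreover have "f N \<le> 1" unfolding f_def using norm_rsl_corr_le by (simp add: power_le_one)
    moreover have "f 0 = 1" by (simp add: f_def)
    ultimately show ?thesis by linarith
  qed
  have "(\<Sum>k<4 ^ Suc n. f k) = (\<Sum>k<4 ^ n. f (4 * k) + f (4 * k + 1) + f (4 * k + 2) + f (4 * k + 3))"
    by (simp only: power_Suc sum_lessThan_quadruple)
  also have "\<dots> \<le> (\<Sum>k<4 ^ n. 9 / 4 * f k + 5 / 4 * f (k + 1))"
    unfolding f_def by (intro sum_mono rsl_corr_quadruple)
  also have "\<dots> = 9 / 4 * (\<Sum>k<4 ^ n. f k) + 5 / 4 * (\<Sum>k<4 ^ n. f (k + 1))"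
    by (simp add: sum.distrib sum_distrib_left)
  also have "\<dots> \<le> 7 / 2 * (\<Sum>k<4 ^ n. f k)"
    using shift[of "4 ^ n"] by simp
  also have "\<dots> \<le> (7 / 2) ^ Suc n"
    using Suc by (simp add: f_def)
  finally show ?case by (simp add: f_def)
qed simp

text \<open>By Cauchy--Schwarz the squared mean is at most the mean square, hence at most
  \<open>(7 / 2) ^ n / 4 ^ n\<close>.\<close>

lemma average_abs_rsl_autocorrelation: "(\<lambda>n. (\<Sum>k<4 ^ n. \<bar>Re (rsl_corr k)\<bar>) / 4 ^ n) \<longlonglongrightarrow> 0"
proof -
  have le: "((\<Sum>k<4 ^ n. \<bar>Re (rsl_corr k)\<bar>) / 4 ^ n)\<^sup>2 \<le> (7 / 8) ^ n" for n
  proof -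
    have "(\<Sum>k<4 ^ n. \<bar>Re (rsl_corr k)\<bar>)\<^sup>2 \<le> (\<Sum>k<(4::nat) ^ n. (1::real)) * (\<Sum>k<4 ^ n. \<bar>Re (rsl_corr k)\<bar>\<^sup>2)"
      using Cauchy_Schwarz_ineq_sum[of "\<lambda>_. 1" "\<lambda>k. \<bar>Re (rsl_corr k)\<bar>" "{..<4 ^ n}"] by simp
    also have "\<dots> \<le> 4 ^ n * (\<Sum>k<4 ^ n. (norm (rsl_corr k))\<^sup>2)"
      by (simp only: sum_constant card_lessThan of_nat_power of_nat_numeral mult_1_right,
          intro mult_left_mono sum_mono power_mono abs_Re_le_cmod abs_ge_zero) simp
    also have "\<dots> \<le> 4 ^ n * (7 / 2) ^ n"
      using sum_norm_rsl_corr_square by simp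
    finally have "(\<Sum>k<4 ^ n. \<bar>Re (rsl_corr k)\<bar>)\<^sup>2 \<le> 4 ^ n * (7 / 2) ^ n" .
    then have "((\<Sum>k<4 ^ n. \<bar>Re (rsl_corr k)\<bar>) / 4 ^ n)\<^sup>2 \<le> 4 ^ n * (7 / 2) ^ n / (4 ^ n)\<^sup>2"
      unfolding power_divide by (intro divide_right_mono) auto
    also have "\<dots> = (7 / 2) ^ n / 4 ^ n"
      by (simp add: power2_eq_square)
    also have "\<dots> = (7 / 8) ^ n"
      unfolding power_divide[symmetric] by simp
    finally show ?thesis .
  qed
  have "(\<lambda>n. (7 / 8 :: real) ^ n) \<longlonglongrightarrow> 0"
    by (rule LIMSEQ_realpow_zero) auto
  then have "(\<lambda>n. ((\<Sum>k<4 ^ n. \<bar>Re (rsl_corr k)\<bar>) / 4 ^ n)\<^sup>2) \<longlonglongrightarrow> 0"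
    by (rule Lim_null_comparison[OF always_eventually, rotated])
       (simp only: real_norm_def abs_power2 le simp_thms)
  then show ?thesis by simp
qed

lemma rsl_diffraction_fourier:
  assumes "is_diffraction_measure rsl \<sigma>"
  shows "(LINT \<theta>|\<sigma>. fourier_char k \<theta>) = of_real (Re (rsl_corr (nat \<bar>k\<bar>)))"
  using assms by (simp add: is_diffraction_measure_def fourier_char_def autocorrelation_rsl)

text \<open>The decay is known at the lengths \<open>4 ^ n\<close>. This suffices, because the full
  sequence of averages already converges to the mass of \<open>t\<close>.\<close>

lemma rsl_diffraction_no_atoms:
  assumes \<sigma>: "is_diffraction_measure rsl \<sigma>" and t: "t \<in> {0..<1}"
  shows "measure \<sigma> {t} = 0"
proof -
  let ?s = "\<lambda>N. (\<Sum>k<N. (LINT \<theta>|\<sigma>. fourier_char (int k) \<theta>) * cnj (fourier_char (int k) t)) / of_nat N"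
  have "?s \<longlonglongrightarrow> of_real (measure \<sigma> {t})"
    using measure_singleton_fourier \<sigma> t unfolding is_diffraction_measure_def by blast
  moreover have "strict_mono (\<lambda>n. (4::nat) ^ n)" by (simp add: strict_mono_def)
  ultimately have "(\<lambda>n. ?s (4 ^ n)) \<longlonglongrightarrow> of_real (measure \<sigma> {t})"
    by (auto dest: LIMSEQ_subseq_LIMSEQ simp: o_def)
  moreover have "norm (?s (4 ^ n)) \<le> (\<Sum>k<4 ^ n. \<bar>Re (rsl_corr k)\<bar>) / 4 ^ n" for n
  proof -
    have "norm (\<Sum>k<4 ^ n. (LINT \<theta>|\<sigma>. fourier_char (int k) \<theta>) * cnj (fourier_char (int k) t))
        \<le> (\<Sum>k<4 ^ n. \<bar>Re (rsl_corr k)\<bar>)"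
      by (rule sum_norm_le) (simp add: rsl_diffraction_fourier[OF \<sigma>] norm_mult)
    then show ?thesis by (simp add: norm_divide norm_power divide_right_mono)
  qed
  then have "(\<lambda>n. ?s (4 ^ n)) \<longlonglongrightarrow> 0"
    by (intro Lim_null_comparison[OF always_eventually average_abs_rsl_autocorrelation]) auto
  ultimately have "complex_of_real (measure \<sigma> {t}) = 0"
    by (rule LIMSEQ_unique)
  then show ?thesis by simp
qed

section \<open>Singularity\<close>

lemma rsl_corr_power2: "rsl_corr (2 ^ d) = - 1 / 3 + (if even d then 2 / 3 else - 2 / 3) * \<i>"
  by (induction d) (use rsl_corr_1 in \<open>auto simp: rsl_corr_double\<close>)

text \<open>\<open>2 ^ Suc d - 1\<close> is twice \<open>2 ^ d - 1\<close> plus 1, and the successor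
  of \<open>2 ^ d - 1\<close> is a power of two, so the odd recursion closes up on these two
  families.\<close>

lemma rsl_corr_power2_minus_1:
  "rsl_corr (2 ^ d - 1) = (if even d then Complex (5 / 9 + 4 / 9 * (1 / 2) ^ d) 0
     else Complex (- 1 / 3) (4 / 9 + 4 / 9 * (1 / 2) ^ d))"
proof (induction d)
  case (Suc d)
  have "(1::nat) \<le> 2 ^ d" by simp
  then have "2 ^ Suc d - 1 = 2 * (2 ^ d - 1) + (1::nat)" "2 ^ d - 1 + 1 = (2::nat) ^ d"
    unfolding power_Suc by linarith+
  then have step: "rsl_corr (2 ^ Suc d - 1) = \<i> / 2 * (cnj (rsl_corr (2 ^ d - 1)) - cnj (rsl_corr (2 ^ d)))"
    using rsl_corr_double_Suc[of "2 ^ d - 1"] by simp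
  show ?case
    unfolding step Suc rsl_corr_power2 by (simp add: complex_eq_iff)
qed (simp add: complex_eq_iff)

text \<open>Doubling the distance only conjugates the correlation. Hence the autocorrelation at
  \<open>2 ^ i - 2 ^ j\<close> depends on the gap of the exponents alone.\<close>

lemma Re_rsl_corr_power2_mult: "Re (rsl_corr (2 ^ i * m)) = Re (rsl_corr m)"
  by (induction i) (simp_all add: mult.assoc rsl_corr_double)

text \<open>The covariance of the characters with frequencies \<open>2 ^ i\<close> and \<open>2 ^ (i + d)\<close> under the diffraction measure.\<close>

definition lacunary_cov :: "nat \<Rightarrow> real" where
  "lacunary_cov d = Re (rsl_corr (2 ^ d - 1)) - 1 / 9"

lemma lacunary_cov_eq: "lacunary_cov d = (if even d then 4 / 9 + 4 / 9 * (1 / 2) ^ d else - 4 / 9)"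
  unfolding lacunary_cov_def rsl_corr_power2_minus_1 by simp

text \<open>The terms alternate between \<open>- 4 / 9\<close> and slightly more than
  \<open>4 / 9\<close>, starting with the former, so the partial sums stay bounded. The intervals
  are shaped to pass through the induction.\<close>

lemma sum_lacunary_cov:
  "(\<Sum>d<n. lacunary_cov (Suc d)) \<in> (if even n then {0..4 / 9 * (1 - (1 / 2) ^ n)} else {- 4 / 9..- 4 / 9 * (1 / 2) ^ n})"
proof (induction n)
  case (Suc n)
  define p :: real where "p = (1 / 2) ^ n"
  have "0 \<le> p" by (simp add: p_def)
  with Suc lacunary_cov_eq[of "Suc n"] show ?case
    by (cases "even n") (auto simp: p_def[symmetric])
qed simp

section \<open>Averages of functions whose covariances depend on the distance of indices\<close>

text \<open>With truncated subtraction \<open>i - j + (j - i)\<close> is the distance of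
  \<open>i\<close> and \<open>j\<close>. Row and column \<open>N\<close> add \<open>b 0\<close> and
  twice a partial sum, at most \<open>3 * K\<close> together.\<close>

lemma sum_sum_dist_le:
  fixes b :: "nat \<Rightarrow> real"
  assumes "b 0 \<le> K" "\<And>n. (\<Sum>d<n. b (Suc d)) \<le> K"
  shows "(\<Sum>i<N. \<Sum>j<N. b (i - j + (j - i))) \<le> 3 * K * real N"
proof (induction N)
  case (Suc N)
  have "(\<Sum>j<N. b (N - j + (j - N))) = (\<Sum>d<N. b (Suc d))"
    by (rule sum.reindex_bij_witness[of _ "\<lambda>d. N - Suc d" "\<lambda>j. N - Suc j"]) (auto simp: Suc_diff_Suc)
  moreover have "(\<Sum>i<N. b (i - N + (N - i))) = (\<Sum>d<N. b (Suc d))"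
    by (rule sum.reindex_bij_witness[of _ "\<lambda>d. N - Suc d" "\<lambda>j. N - Suc j"]) (auto simp: Suc_diff_Suc)
  ultimately have "(\<Sum>i<Suc N. \<Sum>j<Suc N. b (i - j + (j - i))) =
      (\<Sum>i<N. \<Sum>j<N. b (i - j + (j - i))) + 2 * (\<Sum>d<N. b (Suc d)) + b 0"
    by (simp add: sum.distrib)
  with Suc assms(1) assms(2)[of N] show ?case by (simp add: algebra_simps)
qed simp

lemma averages_AE_subseq:
  fixes u :: "nat \<Rightarrow> 'a \<Rightarrow> complex"
  assumes int: "\<And>i j. integrable M (\<lambda>x. u i x * cnj (u j x))"
    and cov: "\<And>i j. (LINT x|M. u i x * cnj (u j x)) = of_real (b (i - j + (j - i)))"
    and b: "b 0 \<le> K" "\<And>n. (\<Sum>d<n. b (Suc d)) \<le> K"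
    and r: "strict_mono (r :: nat \<Rightarrow> nat)"
  obtains q :: "nat \<Rightarrow> nat" where "strict_mono q"
    "AE x in M. (\<lambda>n. (\<Sum>j<r (q n). u j x) / of_nat (r (q n))) \<longlonglongrightarrow> 0"
proof -
  define h where "h N x = (norm (\<Sum>j<N. u j x))\<^sup>2 / (real N)\<^sup>2" for N x
  have h0: "0 \<le> h N x" for N x by (simp add: h_def)
  have eq: "(\<lambda>x. complex_of_real ((norm (\<Sum>j<N. u j x))\<^sup>2)) = (\<lambda>x. \<Sum>i<N. \<Sum>j<N. u i x * cnj (u j x))" for N
    by (simp only: complex_norm_square cnj_sum sum_product)
  have "integrable M (\<lambda>x. (norm (\<Sum>j<N. u j x))\<^sup>2)" for N
    unfolding complex_of_real_integrable_eq[symmetric] eq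
    by (intro Bochner_Integration.integrable_sum int)
  then have int_h: "integrable M (h N)" for N
    unfolding h_def by simp
  have "complex_of_real (LINT x|M. (norm (\<Sum>j<N. u j x))\<^sup>2) = of_real (\<Sum>i<N. \<Sum>j<N. b (i - j + (j - i)))" for N
    unfolding integral_complex_of_real[symmetric] eq
    by (simp add: Bochner_Integration.integral_sum int cov)
  then have "(LINT x|M. (norm (\<Sum>j<N. u j x))\<^sup>2) = (\<Sum>i<N. \<Sum>j<N. b (i - j + (j - i)))" for N
    using of_real_eq_iff by blast
  with sum_sum_dist_le[of b, OF b] have le: "(LINT x|M. (norm (\<Sum>j<N. u j x))\<^sup>2) \<le> 3 * K * N" for N
    by simp
  have "norm (LINT x|M. norm (h N x)) \<le> 3 * K / N" for N
  proof -
    have "norm (LINT x|M. norm (h N x)) = (LINT x|M. h N x)"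
      using h0 by (simp add: integral_nonneg_AE)
    also have "\<dots> = (LINT x|M. (norm (\<Sum>j<N. u j x))\<^sup>2) / (real N)\<^sup>2"
      by (simp add: h_def)
    also have "\<dots> \<le> 3 * K * N / (real N)\<^sup>2"
      using le by (intro divide_right_mono) auto
    finally show ?thesis by (simp add: power2_eq_square split: if_splits)
  qed
  then have "(\<lambda>N. LINT x|M. norm (h N x)) \<longlonglongrightarrow> 0"
    by (intro Lim_null_comparison[OF always_eventually lim_const_over_n[of "3 * K"]]) auto
  from LIMSEQ_subseq_LIMSEQ[OF this r] have "(\<lambda>n. LINT x|M. norm (h (r n) x)) \<longlonglongrightarrow> 0"
    by (simp add: o_def)
  from tendsto_L1_AE_subseq[OF int_h this] obtain q where q: "strict_mono q"
    and "AE x in M. (\<lambda>n. h (r (q n)) x) \<longlonglongrightarrow> 0"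
    by blast
  from this(2) have "AE x in M. (\<lambda>n. (\<Sum>j<r (q n). u j x) / of_nat (r (q n))) \<longlonglongrightarrow> 0"
  proof eventually_elim
    case (elim x)
    then have "(\<lambda>n. (norm ((\<Sum>j<r (q n). u j x) / of_nat (r (q n))))\<^sup>2) \<longlonglongrightarrow> 0"
      by (simp add: h_def norm_divide power_divide)
    then show ?case
      by (simp only: power_tendsto_0_iff tendsto_norm_zero_iff zero_less_numeral)
  qed
  with q show thesis by (rule that)
qed

section \<open>Lacunary averages under the two measures\<close>

text \<open>The frequencies \<open>2 ^ j\<close> are distinct, so the characters are orthonormal and
  \<open>b\<close> is 1 at distance 0 and 0 elsewhere.\<close>

lemma lacunary_AE_lebesgue:
  assumes r: "strict_mono r"
  obtains q :: "nat \<Rightarrow> nat" where "strict_mono q"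
    "AE \<theta> in circle_lebesgue. (\<lambda>n. (\<Sum>j<r (q n). fourier_char (2 ^ j) \<theta>) / of_nat (r (q n))) \<longlonglongrightarrow> 0"
proof (rule averages_AE_subseq[OF _ _ _ _ r, where K = 1
      and u = "\<lambda>j. fourier_char (2 ^ j)" and b = "\<lambda>d. if d = 0 then 1 else 0" and M = circle_lebesgue])
  fix i j :: nat
  show "integrable circle_lebesgue (\<lambda>\<theta>. fourier_char (2 ^ i) \<theta> * cnj (fourier_char (2 ^ j) \<theta>))"
    unfolding fourier_char_diff[symmetric] by (rule integrable_fourier_char_circle)
  show "(LINT \<theta>|circle_lebesgue. fourier_char (2 ^ i) \<theta> * cnj (fourier_char (2 ^ j) \<theta>)) =
      of_real (if i - j + (j - i) = 0 then 1 else 0)"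
    unfolding fourier_char_diff[symmetric] by (auto simp: integral_circle_lebesgue_fourier_char)
qed (use that in auto)

text \<open>Adding \<open>1 / 3\<close> centres the characters, whose integrals are
  \<open>- 1 / 3\<close>; their covariances are \<open>lacunary_cov\<close> of the distance.\<close>

lemma lacunary_AE_rsl:
  assumes \<sigma>: "is_diffraction_measure rsl \<sigma>"
  obtains r :: "nat \<Rightarrow> nat" where "strict_mono r"
    "AE \<theta> in \<sigma>. (\<lambda>n. (\<Sum>j<r n. fourier_char (2 ^ j) \<theta> + 1 / 3) / of_nat (r n)) \<longlonglongrightarrow> 0"
proof -
  note F = rsl_diffraction_fourier[OF \<sigma>]
  have int: "integrable \<sigma> (fourier_char k)" for k
    using \<sigma> by (intro integrable_circle[of \<sigma> _ 1]) (auto simp: is_diffraction_measure_def)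
  have eq: "(\<lambda>\<theta>. (fourier_char (2 ^ i) \<theta> + 1 / 3) * cnj (fourier_char (2 ^ j) \<theta> + 1 / 3)) =
      (\<lambda>\<theta>. fourier_char (2 ^ i - 2 ^ j) \<theta> + (fourier_char (2 ^ i) \<theta> / 3 +
        (fourier_char (- (2 ^ j)) \<theta> / 3 + fourier_char 0 \<theta> / 9)))" for i j
    by (simp add: fourier_char_diff fourier_char_minus algebra_simps)
  have int': "integrable \<sigma> (\<lambda>\<theta>. (fourier_char (2 ^ i) \<theta> + 1 / 3) * cnj (fourier_char (2 ^ j) \<theta> + 1 / 3))" for i j
    unfolding eq by (intro Bochner_Integration.integrable_add integrable_divide int)
  \<comment> \<open>For \<open>i \<le> j\<close> the difference is
    \<open>2 ^ i * (2 ^ (j - i) - 1)\<close>, and the factor \<open>2 ^ i\<close> does not affect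
    the real part of the correlation.\<close>
  have diff: "Re (rsl_corr (nat \<bar>2 ^ i - 2 ^ j\<bar>)) = lacunary_cov (i - j + (j - i)) + 1 / 9" for i j :: nat
  proof (induction i j rule: linorder_wlog)
    case (le i j)
    have "\<bar>2 ^ i - 2 ^ j\<bar> = int (2 ^ j - 2 ^ i)"
      using le by (simp add: of_nat_diff)
    then have "nat \<bar>2 ^ i - 2 ^ j\<bar> = 2 ^ j - 2 ^ i"
      by (simp only: nat_int)
    also have "\<dots> = 2 ^ i * (2 ^ (j - i) - 1)"
      using le by (simp add: right_diff_distrib' flip: power_add)
    finally show ?case using le by (simp add: Re_rsl_corr_power2_mult lacunary_cov_def)
  next
    case (sym i j)
    then show ?case by (simp add: abs_minus_commute add.commute)
  qed
  have pow: "Re (rsl_corr (nat (2 ^ i))) = - 1 / 3" for i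
    by (simp add: nat_power_eq rsl_corr_power2)
  have cov: "(LINT \<theta>|\<sigma>. (fourier_char (2 ^ i) \<theta> + 1 / 3) * cnj (fourier_char (2 ^ j) \<theta> + 1 / 3)) =
      of_real (lacunary_cov (i - j + (j - i)))" for i j
  proof -
    have "(LINT \<theta>|\<sigma>. (fourier_char (2 ^ i) \<theta> + 1 / 3) * cnj (fourier_char (2 ^ j) \<theta> + 1 / 3)) =
      of_real (Re (rsl_corr (nat \<bar>2 ^ i - 2 ^ j\<bar>)) + (Re (rsl_corr (nat (2 ^ i))) / 3 +
        (Re (rsl_corr (nat (2 ^ j))) / 3 + 1 / 9)))"
      unfolding eq
      by (subst Bochner_Integration.integral_add;
          (intro Bochner_Integration.integrable_add integrable_divide int)?)+
         (simp add: F del: fourier_char_0)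
    then show ?thesis unfolding diff pow by simp
  qed
  show thesis
  proof (rule averages_AE_subseq[where r = "\<lambda>n. n" and K = 1 and M = \<sigma> and b = lacunary_cov
        and u = "\<lambda>j \<theta>. fourier_char (2 ^ j) \<theta> + 1 / 3"])
    fix n
    define p :: real where "p = (1 / 2) ^ n"
    have "0 \<le> p" by (simp add: p_def)
    with sum_lacunary_cov[of n] show "(\<Sum>d<n. lacunary_cov (Suc d)) \<le> 1"
      by (auto simp: p_def[symmetric] split: if_splits)
  qed (rule int' cov that | assumption | simp add: lacunary_cov_eq strict_mono_def)+
qed

lemma rsl_diffraction_singular:
  assumes \<sigma>: "is_diffraction_measure rsl \<sigma>"
  shows "mutually_singular \<sigma> circle_lebesgue"
proof -
  define S where "S N \<theta> = (\<Sum>j<N. fourier_char (2 ^ j) \<theta>) / of_nat N" for N \<theta>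
  define T where "T N \<theta> = (\<Sum>j<N. fourier_char (2 ^ j) \<theta> + 1 / 3) / of_nat N" for N \<theta>
  have sets: "sets \<sigma> = sets circle_lebesgue"
    using \<sigma> by (simp add: is_diffraction_measure_def)
  obtain r where r: "strict_mono r" and "AE \<theta> in \<sigma>. (\<lambda>n. T (r n) \<theta>) \<longlonglongrightarrow> 0"
    unfolding T_def by (rule lacunary_AE_rsl[OF \<sigma>])
  then obtain A where A: "A \<in> null_sets \<sigma>" and A': "\<And>\<theta>. \<theta> \<in> space \<sigma> - A \<Longrightarrow> (\<lambda>n. T (r n) \<theta>) \<longlonglongrightarrow> 0"
    by (auto elim!: AE_E3)
  obtain q where q: "strict_mono q" and "AE \<theta> in circle_lebesgue. (\<lambda>n. S (r (q n)) \<theta>) \<longlonglongrightarrow> 0"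
    unfolding S_def by (rule lacunary_AE_lebesgue[OF r])
  then obtain B where B: "B \<in> null_sets circle_lebesgue"
    and B': "\<And>\<theta>. \<theta> \<in> space circle_lebesgue - B \<Longrightarrow> (\<lambda>n. S (r (q n)) \<theta>) \<longlonglongrightarrow> 0"
    by (auto elim!: AE_E3)
  have space: "space \<sigma> = space circle_lebesgue"
    using sets by (rule sets_eq_imp_space_eq)
  \<comment> \<open>Outside \<open>A\<close> and \<open>B\<close> both averages would tend to 0
    along the common subsequence, although they differ by \<open>1 / 3\<close>; so \<open>A\<close>
    and \<open>B\<close> cover the circle.\<close>
  have "space \<sigma> - B \<subseteq> A"
  proof
    fix \<theta> assume \<theta>: "\<theta> \<in> space \<sigma> - B"
    show "\<theta> \<in> A"
    proof (rule ccontr)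
      assume "\<theta> \<notin> A"
      have "(\<lambda>n. T (r (q n)) \<theta>) \<longlonglongrightarrow> 0"
        using LIMSEQ_subseq_LIMSEQ[OF A'[of \<theta>] q] \<theta> \<open>\<theta> \<notin> A\<close> by (simp add: o_def)
      moreover have "(\<lambda>n. S (r (q n)) \<theta>) \<longlonglongrightarrow> 0"
        using B' \<theta> space by blast
      ultimately have "(\<lambda>n. T (r (q n)) \<theta> - S (r (q n)) \<theta>) \<longlonglongrightarrow> 0"
        using tendsto_diff by fastforce
      \<comment> \<open>Positive length is required: for \<open>N = 0\<close> both averages are 0
        and the difference is not \<open>1 / 3\<close>.\<close>
      moreover have "\<forall>\<^sub>F n in sequentially. T (r (q n)) \<theta> - S (r (q n)) \<theta> = 1 / 3"
      proof -
        have "\<forall>\<^sub>F n in sequentially. 0 < r (q n)"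
          using eventually_compose_filterlim[OF eventually_gt_at_top[of 0] filterlim_subseq[OF strict_mono_o[OF r q]]]
          by (simp add: o_def)
        then show ?thesis
          by eventually_elim (simp add: S_def T_def sum.distrib add_divide_distrib)
      qed
      then have "(\<lambda>n. T (r (q n)) \<theta> - S (r (q n)) \<theta>) \<longlonglongrightarrow> 1 / 3"
        by (rule tendsto_eventually)
      ultimately have "(0::complex) = 1 / 3" by (rule LIMSEQ_unique)
      then show False by simp
    qed
  qed
  then have "space \<sigma> - B \<in> null_sets \<sigma>"
    using B sets by (intro null_sets_subset[OF A] sets.compl_sets) auto
  moreover have "space \<sigma> - (space \<sigma> - B) \<in> null_sets circle_lebesgue"
    using B space null_setsD2[OF B] sets.sets_into_space
    by (metis Diff_Diff_Int inf.absorb_iff2)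
  ultimately show ?thesis
    unfolding mutually_singular_def using sets by blast
qed

theorem theorem3p1:
  "is_diffraction_measure rsl (diffraction_measure rsl) \<and>
   purely_singular_continuous (diffraction_measure rsl)"
proof -
  have "\<bar>rsl n\<bar> = 1" for n
    unfolding rsl_def by (cases "rsl_fixpoint n") auto
  moreover have "convergent (autocorrelation_mean rsl k)" for k
    using autocorrelation_mean_rsl by (rule convergentI)
  ultimately have \<sigma>: "is_diffraction_measure rsl (diffraction_measure rsl)"
    by (rule is_diffraction_measure_diffraction_measure)
  then interpret finite_measure "diffraction_measure rsl"
    by (simp add: is_diffraction_measure_def)
  have space: "space (diffraction_measure rsl) = {0..<1}"
    using \<sigma> sets_eq_imp_space_eq[of "diffraction_measure rsl" circle_lebesgue]
    by (simp add: is_diffraction_measure_def)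
  \<comment> \<open>The total mass is the coefficient at frequency 0, that is,
    \<open>rsl_corr 0\<close>.\<close>
  have "measure (diffraction_measure rsl) (space (diffraction_measure rsl)) = 1"
    using rsl_diffraction_fourier[OF \<sigma>, of 0] by (simp add: scaleR_conv_of_real)
  then have "emeasure (diffraction_measure rsl) (space (diffraction_measure rsl)) \<noteq> 0"
    by (simp add: emeasure_eq_measure)
  moreover have "emeasure (diffraction_measure rsl) {\<theta>} = 0" if "\<theta> \<in> space (diffraction_measure rsl)" for \<theta>
    using rsl_diffraction_no_atoms[OF \<sigma>] that space by (simp add: emeasure_eq_measure)
  ultimately show ?thesis
    using \<sigma> rsl_diffraction_singular[OF \<sigma>] by (simp add: purely_singular_continuous_def)
qed

end
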